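(* Let $m,n,k$ be positive integers with $2\le k\le\min\{m,n\}$. Let $\lambda=(\lambda_1,\dots,\lambda_m)$ and $\mu=(\mu_1,\dots,\mu_m)$ be partitions (parts of $\mu$ may be $0$) such that $\mu\subset\lambda$, $\lambda_1=n$, and - $\lambda_m\ge k$, - $\mu$ has at least $k$ zero parts, - $\lambda_1-\mu_1\ge k$, and - $\lambda_1=\lambda_2=\cdots=\lambda_\alpha=n$ for some $\alpha\ge k$. Write $\bar\lambda/\bar\mu$ for the skew partition whose Young diagram is the planar dual graph of $\lambda/\mu$. Then the number of maximal $I_k$-avoiding $(0,1)$-fillings of $\lambda/\mu$ is $$|\mathcal{F}_{\lambda/\mu;k}| = \det\left[f\big(\gamma_{k-1-j,\,i-1}(\bar\lambda),\,\gamma_{k-1-j,\,i-1}(\bar\mu)\big)\right]_{i,j=1}^{k-1}.$$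
   Context: Partitions are weakly decreasing sequences of nonnegative integers; $\mu\subset\lambda$ means $\mu_i\le\lambda_i$ for all $i$. The Young diagram of $\lambda/\mu$ consists of the boxes (row $i$, column $c$) with $\mu_i<c\le\lambda_i$, rows numbered top to bottom and columns left to right. A $(0,1)$-filling of a region $R$ assigns $0$ or $1$ to each box of $R$. It contains $I_k$ if there are rows $r_1<\dots<r_k$ and columns $c_1<\dots<c_k$ such that all boxes $(r_i,c_j)$ lie in $R$ and each box $(r_i,c_i)$ is filled with $1$ (entries in boxes $(r_i,c_j)$, $i\neq j$, are arbitrary); otherwise it is $I_k$-avoiding. It is maximal if it has the maximum possible number of $1$'s among all $I_k$-avoiding $(0,1)$-fillings of $R$. $\mathcal{F}_{R;k}$ is the set of maximal $I_k$-avoiding $(0,1)$-fillings of $R$, and $\mathcal{F}_{\lambda/\mu;k}$ is the case where $R$ is the Young diagram of $\lambda/\mu$. The planar dual graph of $\lambda/\mu$ has one vertex for each box of the Young diagram of $\lambda/\mu$, with an edge between the vertices of any two adjacent boxes. Drawn in the plane, it is viewed as the Young diagram (drawn with unit squares) of a skew shape $\bar\lambda/\bar\mu$; explicitly $\bar\lambda=(\lambda_2-1,\dots,\lambda_m-1)$ and $\bar\mu=(\mu_1,\dots,\mu_{m-1})$, both regarded as having $m-1$ parts. For a partition $\nu=(\nu_1,\dots,\nu_\ell)$ with $\ell$ (possibly zero) parts and nonnegative integers $a,b$, $\gamma_{a,b}(\nu)=(\nu_{a+1},\dots,\nu_{\ell-b})$ is obtained by deleting the first $a$ and the last $b$ parts.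 For partitions $\mu\subset\lambda$ regarded as having the same number $\ell$ of parts (parts of $\mu$ may be $0$), $$f(\lambda,\mu)=\det\left[\binom{\lambda_j-\mu_i+1}{j-i+1}\right]_{i,j=1}^{\ell},$$ where $\binom{N}{r}=0$ unless $0\le r\le N$, and the empty determinant is $1$. If $a+b$ exceeds the number of parts $\ell$ of the partitions to which $\gamma_{a,b}$ is applied, then $f(\gamma_{a,b}(\cdot),\gamma_{a,b}(\cdot))$ is interpreted as $0$.
   Formalization: The formal theorem also assumes μ_i + (k−1) ≤ λ_{i+k−1} for 1 ≤ i ≤ m−k+1; without it the formula is false, e.g. k=3, λ=(6,6,6,3,3), μ=(3,3,0,0,0) has 9 maximal fillings but determinant 0. *)

theory Defs
  imports "HOL-Library.FuncSet" "Jordan_Normal_Form.Determinant"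
begin

text \<open>
  Partitions are weakly decreasing lists of naturals, with trailing zeros allowed, so that
  the length of the list is the number of parts it is regarded as having.
  The \<open>i\<close>-th part of \<open>lam\<close> is \<open>lam ! (i - 1)\<close>.
\<close>

definition is_partition :: "nat list \<Rightarrow> bool" where
  "is_partition lam \<longleftrightarrow> sorted_wrt (\<ge>) lam"

definition partition_subset :: "nat list \<Rightarrow> nat list \<Rightarrow> bool" where
  "partition_subset mu lam \<longleftrightarrow> length mu = length lam \<and> (\<forall>i < length lam. mu ! i \<le> lam ! i)"

text \<open>Boxes are pairs (row, column), both counted from 1.\<close>

definition skew_diagram :: "nat list \<Rightarrow> nat list \<Rightarrow> (nat \<times> nat) set" where
  "skew_diagram lam mu =
     {(r, c). 1 \<le> r \<and> r \<le> length lam \<and> mu ! (r - 1) < c \<and> c \<le> lam ! (r - 1)}"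

text \<open>Extensional functions, so that distinct fillings differ on some box of the region.\<close>

definition fillings :: "(nat \<times> nat) set \<Rightarrow> (nat \<times> nat \<Rightarrow> nat) set" where
  "fillings R = R \<rightarrow>\<^sub>E {0, 1}"

definition contains_I :: "(nat \<times> nat) set \<Rightarrow> nat \<Rightarrow> (nat \<times> nat \<Rightarrow> nat) \<Rightarrow> bool" where
  "contains_I R k F \<longleftrightarrow>
     (\<exists>r c :: nat \<Rightarrow> nat. strict_mono_on {1..k} r \<and> strict_mono_on {1..k} c \<and>
        (\<forall>i \<in> {1..k}. \<forall>j \<in> {1..k}. (r i, c j) \<in> R) \<and>
        (\<forall>i \<in> {1..k}. F (r i, c i) = 1))"

definition avoiding_fillings :: "(nat \<times> nat) set \<Rightarrow> nat \<Rightarrow> (nat \<times> nat \<Rightarrow> nat) set" where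
  "avoiding_fillings R k = {F \<in> fillings R. \<not> contains_I R k F}"

definition num_ones :: "(nat \<times> nat) set \<Rightarrow> (nat \<times> nat \<Rightarrow> nat) \<Rightarrow> nat" where
  "num_ones R F = card {b \<in> R. F b = 1}"

definition maximal_fillings :: "(nat \<times> nat) set \<Rightarrow> nat \<Rightarrow> (nat \<times> nat \<Rightarrow> nat) set" where
  "maximal_fillings R k =
     {F \<in> avoiding_fillings R k. \<forall>G \<in> avoiding_fillings R k. num_ones R G \<le> num_ones R F}"

text \<open>
  The planar dual graph of \<open>lam/mu\<close> has a unit square for each 2 by 2 block of boxes of
  \<open>lam/mu\<close>; those coming from rows \<open>i\<close> and \<open>i + 1\<close> form row \<open>i\<close> of \<open>dual_outer lam/dual_inner mu\<close>.
  The truncated subtraction is only used for positive parts.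
\<close>

definition dual_outer :: "nat list \<Rightarrow> nat list" where
  "dual_outer lam = map (\<lambda>x. x - 1) (tl lam)"

definition dual_inner :: "nat list \<Rightarrow> nat list" where
  "dual_inner mu = butlast mu"

definition gamma :: "nat \<Rightarrow> nat \<Rightarrow> nat list \<Rightarrow> nat list" where
  "gamma a b nu = drop a (take (length nu - b) nu)"

text \<open>Binomial coefficient with integer arguments, zero unless \<open>0 \<le> r \<le> N\<close>.\<close>

definition binom :: "int \<Rightarrow> int \<Rightarrow> int" where
  "binom N r = (if 0 \<le> r \<and> r \<le> N then int (nat N choose nat r) else 0)"

definition f_det :: "nat list \<Rightarrow> nat list \<Rightarrow> int" where
  "f_det lam mu =
     det (mat (length lam) (length lam)
       (\<lambda>(i, j). binom (int (lam ! j) - int (mu ! i) + 1) (int j - int i + 1)))"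

text \<open>
  \<open>f\<close> evaluated at the truncations by \<open>gamma a b\<close>, with the convention that it vanishes when
  more parts are deleted than there are (as opposed to the empty determinant, which is 1).
\<close>

definition f_gamma :: "nat \<Rightarrow> nat \<Rightarrow> nat list \<Rightarrow> nat list \<Rightarrow> int" where
  "f_gamma a b lam mu =
     (if a + b > length lam then 0 else f_det (gamma a b lam) (gamma a b mu))"

text \<open>
  The determinant formula for the number of maximal fillings fails on thin regions: maximal
  fillings always exist, but the determinant can vanish if \<open>k - 1\<close> nonintersecting paths do not
  fit through the diagram. They fit if every inner corner of \<open>lam/mu\<close> is followed diagonally by
  \<open>k - 1\<close> boxes inside the diagram, i.e. if \<open>mu\<^sub>i + (k - 1) \<le> lam\<^sub>i\<^sub>+\<^sub>k\<^sub>-\<^sub>1\<close> for all \<open>i\<close>.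
  For example, with \<open>k = 3\<close>, \<open>lam = (6,6,6,3,3)\<close> and \<open>mu = (3,3,0,0,0)\<close> there are 9 maximal
  fillings, and with \<open>k = 2\<close>, \<open>lam = (5,5,2,2)\<close> and \<open>mu = (3,3,0,0)\<close> there are 4; both determinants
  are 0. The condition is therefore imposed explicitly. For \<open>k = 2\<close> it says exactly that
  \<open>dual_inner mu\<close> is contained in \<open>dual_outer lam\<close>, and for larger \<open>k\<close> (under the conditions that
  \<open>mu\<close> has \<open>k\<close> zero parts and the last part of \<open>lam\<close> is at least \<open>k\<close>) it implies this.
\<close>

end

theory Submission
  imports Defs
begin

text \<open>
  Put \<open>K = k - 1\<close> and group the boxes into diagonals. The ones on a diagonal of an
  \<open>I\<^sub>k\<close>-avoiding filling form a chain, so there are at most \<open>K\<close> of them, and taking the first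
  \<open>K\<close> boxes of every diagonal shows that a filling is maximal iff every diagonal carries
  as many ones as \<open>K\<close> and its length allow. The ones on consecutive diagonals then interlace, since
  otherwise they would contain a chain of \<open>k\<close> boxes; hence they form \<open>K\<close>
  nonintersecting lattice paths from the lower left to the upper right corner, and conversely each
  path is an antichain, so that \<open>K\<close> of them contain no chain of \<open>k\<close> boxes.

  Nonintersecting paths are counted by a determinant of path numbers: expanding all rows by
  the recurrence for path numbers moves every path one diagonal ahead, and tuples in
  which two paths meet drop out because they give equal rows. Finally the path numbers themselves
  are the Hessenberg determinants \<open>f\<close>, whose last column expansion satisfies the same recurrence.
\<close>

section \<open>Determinants\<close>

text \<open>Laplace expansion along the last row leaves only the subdiagonal 1 and the corner entry
  \<open>y l\<close>. Deleting the column of that 1 gives a matrix of the same shape, one smaller,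
  with \<open>y\<close> still as its last column; keeping \<open>y\<close> arbitrary is what lets
  the induction close.\<close>

lemma det_last_column_hessenberg:
  fixes A :: "nat \<Rightarrow> nat \<Rightarrow> 'a :: comm_ring_1"
  assumes sub: "\<And>i. Suc i \<le> l \<Longrightarrow> A (Suc i) i = 1"
    and below: "\<And>i j. Suc j < i \<Longrightarrow> A i j = 0"
  shows "det (mat (Suc l) (Suc l) (\<lambda>(i, j). if j < l then A i j else y i)) =
    (\<Sum>i\<le>l. (-1) ^ (l - i) * y i * det (mat i i (\<lambda>(i, j). A i j)))"
  using sub
proof (induction l)
  case 0
  have "mat (Suc 0) (Suc 0) (\<lambda>(i, j). if j < 0 then A i j else y i) \<in> carrier_mat 1 1"
    by auto
  then have "det (mat (Suc 0) (Suc 0) (\<lambda>(i, j). if j < 0 then A i j else y i)) = y 0"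
    by (subst laplace_expansion_row[where n=1 and i=0]) (auto simp: cofactor_def det_dim_zero mat_delete_def)
  moreover have "det (mat 0 0 (\<lambda>(i, j). A i j)) = 1"
    by (rule det_dim_zero) auto
  ultimately show ?case by simp
next
  case (Suc l)
  let ?M = "\<lambda>l. mat (Suc l) (Suc l) (\<lambda>(i, j). if j < l then A i j else y i)"
  let ?D = "\<lambda>i. det (mat i i (\<lambda>(i, j). A i j))"
  let ?t = "\<lambda>j. ?M (Suc l) $$ (Suc l, j) * cofactor (?M (Suc l)) (Suc l) j"
  have "det (?M (Suc l)) = (\<Sum>j<Suc (Suc l). ?t j)"
    by (rule laplace_expansion_row) auto
  also have "\<dots> = ?t l + ?t (Suc l)"
  proof -
    have "(\<Sum>j<l. ?t j) = 0"
      by (rule sum.neutral) (auto simp: below)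
    then show ?thesis by simp
  qed
  also have "mat_delete (?M (Suc l)) (Suc l) l = ?M l"
    by (rule eq_matI) (auto simp: mat_delete_def)
  then have "?t l = - det (?M l)"
    using Suc.prems[of l] by (simp add: cofactor_def)
  also have "mat_delete (?M (Suc l)) (Suc l) (Suc l) = mat (Suc l) (Suc l) (\<lambda>(i, j). A i j)"
    by (rule eq_matI) (auto simp: mat_delete_def)
  then have "?t (Suc l) = y (Suc l) * ?D (Suc l)"
    by (simp add: cofactor_def)
  also have "det (?M l) = (\<Sum>i\<le>l. (-1) ^ (l - i) * y i * ?D i)"
    using Suc by auto
  also have "- \<dots> = (\<Sum>i\<le>l. (-1) ^ (Suc l - i) * y i * ?D i)"
    unfolding sum_negf[symmetric] by (rule sum.cong) (auto simp: Suc_diff_le)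
  finally show ?case by simp
qed

lemma det_hessenberg:
  fixes A :: "nat \<Rightarrow> nat \<Rightarrow> 'a :: comm_ring_1"
  assumes sub: "\<And>i. i < l \<Longrightarrow> A (Suc i) i = 1"
    and below: "\<And>i j. Suc j < i \<Longrightarrow> A i j = 0"
  shows "det (mat (Suc l) (Suc l) (\<lambda>(i, j). A i j)) =
    (\<Sum>i\<le>l. (-1) ^ (l - i) * A i l * det (mat i i (\<lambda>(i, j). A i j)))"
proof -
  have "mat (Suc l) (Suc l) (\<lambda>(i, j). A i j) =
      mat (Suc l) (Suc l) (\<lambda>(i, j). if j < l then A i j else A i l)"
    by (rule eq_matI) (auto simp: less_Suc_eq)
  then show ?thesis
    using det_last_column_hessenberg[of l A "\<lambda>i. A i l"] sub below by auto
qed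

text \<open>Multilinearity in the rows: in the Leibniz formula each product of sums expands over the
  choice functions \<open>p\<close>, because the range of summation depends on the row only.\<close>

lemma det_sum_rows:
  fixes q :: "nat \<Rightarrow> 'b \<Rightarrow> 'a :: comm_ring_1"
  assumes "\<And>i. i < K \<Longrightarrow> finite (B i)"
  shows "det (mat K K (\<lambda>(i, j). \<Sum>b\<in>B i. q j b)) =
    (\<Sum>p\<in>PiE {..<K} B. det (mat K K (\<lambda>(i, j). q j (p i))))"
proof -
  let ?P = "{p. p permutes {0..<K}}"
  have expand: "(\<Prod>i = 0..<K. \<Sum>b\<in>B i. q (s i) b) =
      (\<Sum>p\<in>PiE {0..<K} B. \<Prod>i = 0..<K. q (s i) (p i))" for s
    by (rule prod_sum_PiE) (auto simp: assms)
  have "det (mat K K (\<lambda>(i, j). \<Sum>b\<in>B i. q j b)) =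
      (\<Sum>s\<in>?P. signof s * (\<Prod>i = 0..<K. \<Sum>b\<in>B i. q (s i) b))"
    by (subst det_def'[of _ K])
      (auto intro!: sum.cong prod.cong simp: permutes_in_image[where S="{0..<K}", simplified])
  also have "\<dots> = (\<Sum>s\<in>?P. \<Sum>p\<in>PiE {..<K} B. signof s * (\<Prod>i = 0..<K. q (s i) (p i)))"
    unfolding expand lessThan_atLeast0 sum_distrib_left by (rule refl)
  also have "\<dots> = (\<Sum>p\<in>PiE {..<K} B. \<Sum>s\<in>?P. signof s * (\<Prod>i = 0..<K. q (s i) (p i)))"
    by (rule sum.swap)
  also have "\<dots> = (\<Sum>p\<in>PiE {..<K} B. det (mat K K (\<lambda>(i, j). q j (p i))))"
    by (rule sum.cong, simp, subst det_def'[of _ K])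
      (auto intro!: sum.cong prod.cong simp: permutes_in_image[where S="{0..<K}", simplified])
  finally show ?thesis .
qed

lemma det_upper_unitriangular:
  fixes A :: "nat \<Rightarrow> nat \<Rightarrow> 'a :: comm_ring_1"
  assumes "\<And>i. i < K \<Longrightarrow> A i i = 1" and "\<And>i j. j < i \<Longrightarrow> i < K \<Longrightarrow> A i j = 0"
  shows "det (mat K K (\<lambda>(i, j). A i j)) = 1"
proof -
  have "det (mat K K (\<lambda>(i, j). A i j)) = prod_list (diag_mat (mat K K (\<lambda>(i, j). A i j)))"
    by (rule det_upper_triangular[of _ K]) (auto simp: assms)
  also have "\<dots> = (\<Prod>i = 0..<K. A i i)"
    by (simp add: prod_list_diag_prod)
  finally show ?thesis by (simp add: assms)
qed

lemma det_sum_mult: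
  fixes a u :: "nat \<Rightarrow> nat \<Rightarrow> 'a :: comm_ring_1"
  shows "det (mat K K (\<lambda>(i, j). \<Sum>l<K. a i l * u l j)) =
    det (mat K K (\<lambda>(i, j). a i j)) * det (mat K K (\<lambda>(i, j). u i j))"
proof -
  have "mat K K (\<lambda>(i, j). \<Sum>l<K. a i l * u l j) = mat K K (\<lambda>(i, j). a i j) * mat K K (\<lambda>(i, j). u i j)"
    by (rule eq_matI) (auto simp: scalar_prod_def lessThan_atLeast0)
  then show ?thesis
    using det_mult[of "mat K K (\<lambda>(i, j). a i j)" K "mat K K (\<lambda>(i, j). u i j)"] by simp
qed

section \<open>Finite sequences, binomials and partitions\<close>

text \<open>Read backwards, both sequences are the sorted list of one finite set. This recovers a
  tuple of boxes from its underlying set.\<close>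

lemma strict_antimono_on_unique:
  fixes f g :: "nat \<Rightarrow> nat"
  assumes f: "\<And>i j. i < j \<Longrightarrow> j < K \<Longrightarrow> f j < f i"
    and g: "\<And>i j. i < j \<Longrightarrow> j < K \<Longrightarrow> g j < g i"
    and img: "f ` {..<K} = g ` {..<K}" and "i < K"
  shows "f i = g i"
proof -
  have "map f (rev [0..<K]) = map g (rev [0..<K])"
  proof (rule strict_sorted_equal)
    have *: "sorted_wrt (<) (map h (rev [0..<K]))"
      if "\<And>i j. i < j \<Longrightarrow> j < K \<Longrightarrow> h j < h i" for h :: "nat \<Rightarrow> nat"
      using that by (auto simp: sorted_wrt_iff_nth_less rev_nth)
    show "sorted_wrt (<) (map g (rev [0..<K]))" "sorted_wrt (<) (map f (rev [0..<K]))"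
      using *[of f] *[of g] f g by blast+
    show "set (map f (rev [0..<K])) = set (map g (rev [0..<K]))"
      using img by (auto simp: lessThan_atLeast0)
  qed
  then show ?thesis using \<open>i < K\<close> by auto
qed

lemma ex_strict_antimono_enumeration:
  fixes A :: "nat set"
  assumes "finite A" "card A = K"
  obtains f where "\<And>i j. i < j \<Longrightarrow> j < K \<Longrightarrow> f j < f i" and "f ` {..<K} = A"
proof
  let ?f = "\<lambda>i. rev (sorted_list_of_set A) ! i"
  show "?f j < ?f i" if "i < j" "j < K" for i j
    using that assms sorted_wrt_nth_less[OF strict_sorted_list_of_set, of "K - Suc j" "K - Suc i" A]
    by (simp add: rev_nth)
  have "?f ` {..<K} = set (rev (sorted_list_of_set A))"
    using assms by (auto simp: in_set_conv_nth image_iff simp del: set_rev) 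
  then show "?f ` {..<K} = A" using assms by simp
qed

text \<open>Injectivity forces the values to exhaust \<open>{1..K}\<close>, and a set has only one
  decreasing enumeration.\<close>

lemma strict_antimono_on_eq_diff:
  fixes f :: "nat \<Rightarrow> nat"
  assumes "\<And>i j. i < j \<Longrightarrow> j < K \<Longrightarrow> f j < f i" and "\<And>i. i < K \<Longrightarrow> 1 \<le> f i \<and> f i \<le> K" and "i < K"
  shows "f i = K - i"
proof (rule strict_antimono_on_unique[where K=K and f=f and g="\<lambda>i. K - i"])
  have "inj_on f {..<K}"
    by (rule linorder_inj_onI) (use assms(1) in \<open>fastforce simp: neq_iff\<close>)+
  then have "card (f ` {..<K}) = card {1..K}"
    by (simp add: card_image)
  then have "f ` {..<K} = {1..K}"
    by (intro card_subset_eq) (use assms in auto)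
  moreover have "(\<lambda>i. K - i) ` {..<K} = {1..K}"
  proof (intro equalityI subsetI)
    fix x assume "x \<in> {1..K}"
    then have "x = K - (K - x)" "K - x \<in> {..<K}" by auto
    then show "x \<in> (\<lambda>i. K - i) ` {..<K}" by blast
  qed auto
  ultimately show "f ` {..<K} = (\<lambda>i. K - i) ` {..<K}" by simp
qed (use assms in auto)

lemma antimono_diff_le:
  fixes f :: "nat \<Rightarrow> nat"
  assumes "\<And>i j. i < j \<Longrightarrow> j \<le> N \<Longrightarrow> f j < f i" "i \<le> N"
  shows "f i + i \<le> f 0"
  using assms(2)
proof (induction i)
  case (Suc i)
  then show ?case using assms(1)[of i "Suc i"] by simp
qed simp

text \<open>Pascal's rule survives for negative \<open>N\<close>, where every term vanishes, but not
  for \<open>r = -1\<close>: it fails at \<open>N = -1\<close>.\<close>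

lemma binom_pascal: "0 \<le> r \<Longrightarrow> binom (N + 1) (r + 1) = binom N (r + 1) + binom N r"
proof -
  assume r: "0 \<le> r"
  show ?thesis
  proof (cases "0 \<le> N")
    case True
    have "nat (N + 1) = Suc (nat N)" "nat (r + 1) = Suc (nat r)"
      using r True by auto
    moreover have "nat N choose nat x = 0" if "N < x" for x
      using that True by (intro binomial_eq_0) auto
    ultimately show ?thesis
      using r by (auto simp: binom_def)
  qed (use r in \<open>auto simp: binom_def\<close>)
qed

text \<open>Pascal's rule summed against an arbitrary sequence; it carries the induction in
  \<open>paths_binomial\<close>.\<close>

lemma sum_binomial_Suc:
  fixes x :: "nat \<Rightarrow> 'a :: comm_semiring_1"
  shows "(\<Sum>t\<le>Suc p. of_nat (Suc p choose t) * x t) =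
    (\<Sum>t\<le>p. of_nat (p choose t) * x t) + (\<Sum>t\<le>p. of_nat (p choose t) * x (Suc t))"
proof -
  have "(\<Sum>t\<le>p. of_nat (p choose t) * x t) = (\<Sum>t\<le>Suc p. of_nat (p choose t) * x t)"
    by (simp add: binomial_eq_0)
  also have "\<dots> = x 0 + (\<Sum>t\<le>p. of_nat (p choose Suc t) * x (Suc t))"
    by (subst sum.atMost_Suc_shift) simp
  finally show ?thesis
    by (subst sum.atMost_Suc_shift) (simp add: sum.distrib algebra_simps)
qed

section \<open>Parts of partitions\<close>

lemma gamma_nth: "j < length nu - b - a \<Longrightarrow> gamma a b nu ! j = nu ! (a + j)"
  unfolding gamma_def by auto

lemma partition_nth_mono: "is_partition nu \<Longrightarrow> i \<le> j \<Longrightarrow> j < length nu \<Longrightarrow> nu ! j \<le> nu ! i"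
  unfolding is_partition_def using sorted_wrt_nth_less[of "(\<ge>)" nu i j] by (cases "i = j") auto

text \<open>The zeros of a weakly decreasing list form a final segment; a nonzero entry at
  \<open>i\<close> would leave fewer than \<open>k\<close> places for them.\<close>

lemma partition_zero_parts:
  assumes "is_partition mu" "k \<le> card {i. i < length mu \<and> mu ! i = 0}"
    and "length mu \<le> i + k" "i < length mu"
  shows "mu ! i = 0"
proof (rule ccontr)
  assume "mu ! i \<noteq> 0"
  then have "i < j" if "j < length mu" "mu ! j = 0" for j
    using partition_nth_mono[OF assms(1), of j i] assms(4) that by (cases "j \<le> i") auto
  then have "{i. i < length mu \<and> mu ! i = 0} \<subseteq> {i<..<length mu}"
    by auto
  then have "card {i. i < length mu \<and> mu ! i = 0} \<le> card {i<..<length mu}"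
    by (intro card_mono) auto
  then show False
    using assms by auto
qed

section \<open>Path numbers\<close>

text \<open>\<open>L\<close> and \<open>M\<close> are the parts of the outer and inner partition
  counted from 1, and \<open>K\<close> stands for k - 1. The condition \<open>thick\<close> serves
  to show that every diagonal between the two extreme corners has at least \<open>K\<close>
  boxes.\<close>

locale skew_region =
  fixes L M :: "nat \<Rightarrow> nat" and m n K :: nat
  assumes L_antimono: "1 \<le> r \<Longrightarrow> r \<le> s \<Longrightarrow> s \<le> m \<Longrightarrow> L s \<le> L r"
    and M_antimono: "1 \<le> r \<Longrightarrow> r \<le> s \<Longrightarrow> s \<le> m \<Longrightarrow> M s \<le> M r"
    and M_le_L: "1 \<le> r \<Longrightarrow> r \<le> m \<Longrightarrow> M r \<le> L r"
    and K_pos: "1 \<le> K" and K_less_m: "K < m"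
    and L_top: "1 \<le> r \<Longrightarrow> r \<le> K \<Longrightarrow> L r = n"
    and L_bottom: "K < L m"
    and M_bottom: "m \<le> r + K \<Longrightarrow> r \<le> m \<Longrightarrow> M r = 0"
    and M_top: "M 1 + K < n"
    and thick: "1 \<le> r \<Longrightarrow> r + K \<le> m \<Longrightarrow> M r + K \<le> L (r + K)"
begin

definition R :: "(nat \<times> nat) set" where
  "R = {(r, c). 1 \<le> r \<and> r \<le> m \<and> M r < c \<and> c \<le> L r}"

lemma mem_R [simp]: "(r, c) \<in> R \<longleftrightarrow> 1 \<le> r \<and> r \<le> m \<and> M r < c \<and> c \<le> L r"
  by (simp add: R_def)

lemma L_le_n: "1 \<le> r \<Longrightarrow> r \<le> m \<Longrightarrow> L r \<le> n"
  using L_antimono[of 1 r] L_top[of 1] K_pos by simp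

lemma K_less_L: "1 \<le> r \<Longrightarrow> r \<le> m \<Longrightarrow> K < L r"
  using L_antimono[of r m] L_bottom by simp

text \<open>The number of lattice paths with steps up and right inside \<open>R\<close> from a box to \<open>(b, n)\<close>,
  provided that row \<open>b\<close> extends to column \<open>n\<close>.\<close>

function paths :: "nat \<Rightarrow> nat \<times> nat \<Rightarrow> int" where
  "paths b (r, c) = (if (r, c) \<notin> R \<or> r < b then 0 else if r = b then 1
     else paths b (r - 1, c) + paths b (r, Suc c))"
  by pat_completeness auto
termination
proof (relation "measure (\<lambda>(b, r, c). r + (Suc n - c))")
  fix b r c assume "\<not> ((r, c) \<notin> R \<or> r < b)" "r \<noteq> b"
  then show "((b, r - 1, c), b, r, c) \<in> measure (\<lambda>(b, r, c). r + (Suc n - c))"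
    "((b, r, Suc c), b, r, c) \<in> measure (\<lambda>(b, r, c). r + (Suc n - c))"
    using L_le_n[of r] by auto
qed auto

declare paths.simps [simp del]

lemma paths_eq_0: "x \<notin> R \<or> fst x < b \<Longrightarrow> paths b x = 0"
  by (cases x) (simp add: paths.simps)

lemma paths_row: "(b, c) \<in> R \<Longrightarrow> paths b (b, c) = 1"
  by (simp add: paths.simps)

text \<open>Rows \<open>b <= K\<close> reach column \<open>n\<close>, so on the target row the
  constant value 1 obeys the recurrence too, except at the end point. All paths can thus be advanced
  uniformly.\<close>

lemma paths_step:
  assumes "(r, c) \<in> R" "1 \<le> b" "b \<le> K" "(r, c) \<noteq> (b, n)"
  shows "paths b (r, c) = paths b (r - 1, c) + paths b (r, Suc c)"
proof (cases r b rule: linorder_cases)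
  case less
  then show ?thesis by (simp add: paths_eq_0 less_imp_diff_less)
next
  case equal
  then have "(b, Suc c) \<in> R"
    using assms L_top[of b] by auto
  moreover have "paths b (b - 1, c) = 0"
    using assms by (intro paths_eq_0) auto
  ultimately show ?thesis
    using equal assms(1) by (simp add: paths_row del: mem_R)
next
  case greater
  then show ?thesis
    using assms(1) by (subst paths.simps) (simp del: mem_R)
qed

text \<open>This is \<open>f\<close> for the rows \<open>b, \<dots>, b + l - 1\<close> of the dual shape, whose outer parts are
  \<open>L (r + 1) - 1\<close>; this cancels the \<open>+ 1\<close> in the upper binomial index.\<close>

definition row_det :: "nat \<Rightarrow> nat \<Rightarrow> int" where
  "row_det b l = det (mat l l (\<lambda>(i, j).
     binom (int (L (b + j + 1)) - int (M (b + i))) (int j - int i + 1)))"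

text \<open>For \<open>l > 0\<close> this is the last column expansion of \<open>row_det b l\<close>
  with the outer part \<open>L (b + l)\<close> in that column replaced by \<open>x + 1\<close>.
  Varying \<open>x\<close> yields a difference equation in the column of a box.\<close>

definition row_sum :: "nat \<Rightarrow> nat \<Rightarrow> int \<Rightarrow> int" where
  "row_sum b l x = (\<Sum>i<l. (-1) ^ (l - Suc i) *
     binom (x - int (M (b + i)) + 1) (int l - int i) * row_det b i)"

lemma row_det_0 [simp]: "row_det b 0 = 1"
  unfolding row_det_def by (rule det_dim_zero) auto

lemma row_sum_0 [simp]: "row_sum b 0 x = 0"
  by (simp add: row_sum_def)

lemma row_det_Suc:
  assumes "1 \<le> b" "b + l < m"
  shows "row_det b (Suc l) = row_sum b (Suc l) (int (L (b + l + 1)) - 1)"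
proof -
  have "row_det b (Suc l) =
      (\<Sum>i\<le>l. (-1) ^ (l - i) * binom (int (L (b + l + 1)) - int (M (b + i))) (int l - int i + 1) * row_det b i)"
    unfolding row_det_def
  proof (rule det_hessenberg)
    \<comment> \<open>The lower index is 0, so the value is 1 provided that the upper index, the
      length of row \<open>b + i + 1\<close>, is nonnegative.\<close>
    show "binom (int (L (b + i + 1)) - int (M (b + Suc i))) (int i - int (Suc i) + 1) = 1"
      if "i < l" for i
      using that assms M_le_L[of "b + i + 1"] by (simp add: binom_def)
    show "binom (int (L (b + j + 1)) - int (M (b + i))) (int j - int i + 1) = 0"
      if "Suc j < i" for i j
      using that by (simp add: binom_def)
  qed
  then show ?thesis
    by (simp add: row_sum_def lessThan_Suc_atMost algebra_simps)
qed

text \<open>Pascal's rule in each term with \<open>i < l\<close> lowers the size index and flips the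
  sign. The term \<open>i = l\<close> is linear in \<open>x\<close> with slope
  \<open>row_det b l\<close>, but only where its binomial is not truncated, hence the lower bound on
  \<open>x\<close>.\<close>

lemma row_sum_Suc_diff:
  assumes "int (M (b + l)) \<le> x"
  shows "row_sum b (Suc l) x - row_sum b (Suc l) (x - 1) = row_det b l - row_sum b l (x - 1)"
proof -
  define f where "f = (\<lambda>l i x. (-1) ^ (l - Suc i) *
    binom (x - int (M (b + i)) + 1) (int l - int i) * row_det b i)"
  have row_sum: "row_sum b l x = (\<Sum>i<l. f l i x)" for l x
    by (simp add: row_sum_def f_def)
  have step: "f (Suc l) i x - f (Suc l) i (x - 1) = - f l i (x - 1)" if "i < l" for i
  proof -
    define r where "r = int l - int i"
    define N where "N = x - int (M (b + i))"
    have "binom (N + 1) (r + 1) = binom N (r + 1) + binom N r"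
      by (rule binom_pascal) (use that in \<open>simp add: r_def\<close>)
    moreover have "Suc l - Suc i = Suc (l - Suc i)"
      using that by simp
    moreover have "x - int (M (b + i)) + 1 = N + 1" "x - 1 - int (M (b + i)) + 1 = N"
      "int (Suc l) - int i = r + 1" "int l - int i = r"
      by (auto simp: N_def r_def)
    ultimately show ?thesis
      unfolding f_def by (simp only:) (simp add: algebra_simps)
  qed
  have "row_sum b (Suc l) x - row_sum b (Suc l) (x - 1) =
      (\<Sum>i<l. f (Suc l) i x - f (Suc l) i (x - 1)) + (f (Suc l) l x - f (Suc l) l (x - 1))"
    by (simp add: row_sum sum_subtractf)
  also have "(\<Sum>i<l. f (Suc l) i x - f (Suc l) i (x - 1)) = - row_sum b l (x - 1)"
    unfolding row_sum sum_negf[symmetric] by (rule sum.cong) (auto simp: step)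
  also have "f (Suc l) l x - f (Suc l) l (x - 1) = row_det b l"
    using assms by (auto simp: f_def binom_def left_diff_distrib[symmetric])
  finally show ?thesis by simp
qed

lemma row_sum_eq_0:
  assumes "\<And>i. i < l \<Longrightarrow> x < int (M (b + i))"
  shows "row_sum b l x = 0"
  unfolding row_sum_def
proof (rule sum.neutral, rule ballI)
  fix i assume "i \<in> {..<l}"
  then show "(-1) ^ (l - Suc i) * binom (x - int (M (b + i)) + 1) (int l - int i) * row_det b i = 0"
    using assms[of i] by (simp add: binom_def)
qed

text \<open>Both sides obey the same recurrence. The box above contributes a difference of two
  values of \<open>row_sum\<close> by \<open>row_sum_Suc_diff\<close>, the box to the right
  contributes the formula one column further, and the sum telescopes. The cases below check that the
  formula is also right when one of these boxes leaves the region.\<close>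

lemma paths_eq_row_det_diff:
  assumes "1 \<le> b" "b \<le> K" "(r, c) \<in> R" "b \<le> r"
  shows "paths b (r, c) = row_det b (r - b) - row_sum b (r - b) (int c - 2)"
  using assms
proof (induction "r + (n - c)" arbitrary: r c rule: less_induct)
  case less
  note rc = less.prems(3)
  show ?case
  proof (cases "r = b")
    case True
    then show ?thesis using rc paths_row by simp
  next
    case False
    then obtain l where r: "r = b + Suc l"
      using less.prems(4) by (metis add_Suc_right le_imp_less_or_eq less_iff_Suc_add)
    have "row_sum b (Suc l) (int c - 1) - row_sum b (Suc l) (int c - 2) =
        row_det b l - row_sum b l (int c - 2)" if "M (b + l) < c"
      using row_sum_Suc_diff[of b l "int c - 1"] that by simp
    have up: "paths b (r - 1, c) = row_sum b (Suc l) (int c - 1) - row_sum b (Suc l) (int c - 2)"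
    proof (cases "(r - 1, c) \<in> R")
      case True
      then have "paths b (r - 1, c) = row_det b (r - 1 - b) - row_sum b (r - 1 - b) (int c - 2)"
        using less.prems r by (intro less.hyps) auto
      then show ?thesis
        using row_sum_Suc_diff[of b l "int c - 1"] True r by simp
    next
      \<comment> \<open>The box above lies left of its row, so \<open>c\<close> is at most every
        earlier inner part and all binomials have upper index at most 0.\<close>
      case F: False
      have "c \<le> M (b + l)"
        using F rc r less.prems L_antimono[of "b + l" r] by auto
      then have c_le: "c \<le> M (b + i)" if "i \<le> l" for i
        using that M_antimono[of "b + i" "b + l"] r rc less.prems by fastforce
      have "int c - 1 < int (M (b + i))" if "i < Suc l" for i
        using that c_le[of i] by linarith
      then have "row_sum b (Suc l) (int c - 1) = 0" "row_sum b (Suc l) (int c - 2) = 0"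
        using row_sum_eq_0[of "Suc l" "int c - 1" b] row_sum_eq_0[of "Suc l" "int c - 2" b] by force+
      then show ?thesis using F paths_eq_0[of "(r - 1, c)" b] by simp
    qed
    have right: "paths b (r, Suc c) = row_det b (Suc l) - row_sum b (Suc l) (int c - 1)"
    proof (cases "(r, Suc c) \<in> R")
      case True
      then have "paths b (r, Suc c) = row_det b (r - b) - row_sum b (r - b) (int (Suc c) - 2)"
        using less.prems L_le_n[of r] by (intro less.hyps) auto
      then show ?thesis using r by simp
    next
      case F: False
      \<comment> \<open>One column past the end of the row the formula reads \<open>row_det\<close>
        minus its own last column expansion, which is 0.\<close>
      then have "c = L r" using rc by auto
      then show ?thesis
        using row_det_Suc[of b l] F r rc less.prems paths_eq_0 by simp
    qed
    have "paths b (r, c) = paths b (r - 1, c) + paths b (r, Suc c)"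
      using False less.prems by (intro paths_step) auto
    then show ?thesis
      using up right r by simp
  qed
qed

lemma paths_first_column:
  assumes "1 \<le> b" "b \<le> K" "b \<le> r" "r \<le> m" "M r = 0"
  shows "paths b (r, 1) = row_det b (r - b)"
proof -
  have "paths b (r, 1) = row_det b (r - b) - row_sum b (r - b) (int 1 - 2)"
    using assms K_less_L[of r] by (intro paths_eq_row_det_diff) auto
  \<comment> \<open>In column 1 the upper binomial indices are \<open>- M (b + i)\<close>, at most
    0, while the lower ones are positive.\<close>
  moreover have "row_sum b (r - b) (int 1 - 2) = 0"
    by (rule row_sum_eq_0) simp
  ultimately show ?thesis by simp
qed

text \<open>\<open>p\<close> is the number of steps missing to the diagonal of
  \<open>(m, K)\<close>. In the lower left corner no boundary is met on the way, so the recurrence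
  can be iterated \<open>p\<close> times; \<open>t\<close> counts the steps to the right.\<close>

lemma paths_binomial:
  assumes "1 \<le> b" "b \<le> K" "r \<le> m" "1 \<le> c" "c + m + p = K + r"
  shows "paths b (r, c) = (\<Sum>t\<le>p. int (p choose t) * paths b (r - (p - t), c + t))"
  using assms(3-5)
proof (induction p arbitrary: r c)
  case 0
  then show ?case by simp
next
  case (Suc p)
  let ?x = "\<lambda>t. paths b (r - (Suc p - t), c + t)"
  have "(r, c) \<in> R"
    using Suc.prems K_less_m K_less_L[of r] M_bottom[of r] by auto
  then have "paths b (r, c) = paths b (r - 1, c) + paths b (r, Suc c)"
    using assms Suc.prems M_top by (intro paths_step) auto
  also have "paths b (r - 1, c) = (\<Sum>t\<le>p. int (p choose t) * ?x t)"
    using Suc.prems K_less_m by (subst Suc.IH) (auto simp: Suc_diff_le)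
  also have "paths b (r, Suc c) = (\<Sum>t\<le>p. int (p choose t) * ?x (Suc t))"
    using Suc.prems by (subst Suc.IH) auto
  also have "(\<Sum>t\<le>p. int (p choose t) * ?x t) + (\<Sum>t\<le>p. int (p choose t) * ?x (Suc t)) =
      (\<Sum>t\<le>Suc p. int (Suc p choose t) * ?x t)"
    by (rule sum_binomial_Suc[symmetric])
  finally show ?case .
qed

text \<open>Passing from the starting points in the first column to the boxes of the first diagonal
  with \<open>K\<close> boxes multiplies the path matrix by a unitriangular matrix of binomials.\<close>

lemma det_paths_first_column:
  "det (mat K K (\<lambda>(i, j). paths (K - j) (m - i, 1))) =
   det (mat K K (\<lambda>(i, j). paths (K - j) (m - i, K - i)))"
proof -
  let ?a = "\<lambda>i l. int ((K - 1 - i) choose (K - 1 - l))"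
  have eq: "paths (K - j) (m - i, 1) = (\<Sum>l<K. ?a i l * paths (K - j) (m - l, K - l))"
    if "i < K" "j < K" for i j
  proof -
    let ?p = "K - 1 - i"
    have "paths (K - j) (m - i, 1) =
        (\<Sum>t\<le>?p. int (?p choose t) * paths (K - j) (m - i - (?p - t), 1 + t))"
      using that K_less_m by (intro paths_binomial) auto
    also have "\<dots> = (\<Sum>t\<le>?p. int (?p choose t) * paths (K - j) (m - (K - Suc t), K - (K - Suc t)))"
      using that K_less_m by (intro sum.cong refl) (auto intro!: arg_cong[where f="paths _"])
    \<comment> \<open>Beyond \<open>?p\<close> the binomials vanish, so all \<open>i\<close> can
      share the range \<open>t < K\<close>; reversing it makes the box \<open>(m - l, K - l)\<close>
      the summation index.\<close>
    also have "\<dots> = (\<Sum>t<K. int (?p choose t) * paths (K - j) (m - (K - Suc t), K - (K - Suc t)))"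
      using that by (intro sum.mono_neutral_left) auto
    also have "\<dots> = (\<Sum>t<K. ?a i (K - Suc t) * paths (K - j) (m - (K - Suc t), K - (K - Suc t)))"
      by (intro sum.cong) auto
    also have "\<dots> = (\<Sum>l<K. ?a i l * paths (K - j) (m - l, K - l))"
      by (rule sum.nat_diff_reindex)
    finally show ?thesis .
  qed
  have "mat K K (\<lambda>(i, j). paths (K - j) (m - i, 1)) =
      mat K K (\<lambda>(i, j). \<Sum>l<K. ?a i l * paths (K - j) (m - l, K - l))"
    by (rule eq_matI) (auto simp: eq simp del: diff_diff_left One_nat_def)
  then have "det (mat K K (\<lambda>(i, j). paths (K - j) (m - i, 1))) =
      det (mat K K (\<lambda>(i, j). ?a i j)) * det (mat K K (\<lambda>(l, j). paths (K - j) (m - l, K - l)))"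
    by (simp add: det_sum_mult)
  also have "det (mat K K (\<lambda>(i, j). ?a i j)) = 1"
    by (rule det_upper_unitriangular) auto
  finally show ?thesis by simp
qed

text \<open>Of the m - 1 dual rows, m - 1 - a - b remain, starting with row \<open>a + 1\<close>, so
  \<open>f\<close> becomes \<open>row_det (a + 1)\<close> and counts paths from
  \<open>(m - b, 1)\<close> to row \<open>a + 1\<close>. If a + b = m - 1, the empty determinant is
  the single path inside one row; if a + b is larger, the convention 0 matches a start above the
  target row.\<close>

lemma f_gamma_eq_paths:
  assumes L: "\<And>r. 1 \<le> r \<Longrightarrow> r \<le> m \<Longrightarrow> L r = lam ! (r - 1)" and "length lam = m"
    and M: "\<And>r. 1 \<le> r \<Longrightarrow> r \<le> m \<Longrightarrow> M r = mu ! (r - 1)" and "length mu = m"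
    and ab: "a < K" "b < K"
  shows "f_gamma a b (dual_outer lam) (dual_inner mu) = paths (a + 1) (m - b, 1)"
proof (cases "a + b < m")
  case True
  define l where "l = m - b - (a + 1)"
  have len: "length (dual_outer lam) = m - 1" "length (dual_inner mu) = m - 1"
    using assms by (simp_all add: dual_outer_def dual_inner_def)
  then have len_gamma: "length (gamma a b (dual_outer lam)) = l"
    by (simp add: gamma_def l_def)
  have outer: "int (gamma a b (dual_outer lam) ! j) = int (L (a + 1 + j + 1)) - 1" if "j < l" for j
  proof -
    have "gamma a b (dual_outer lam) ! j = dual_outer lam ! (a + j)"
      by (rule gamma_nth) (use that len l_def in auto)
    also have "\<dots> = lam ! (a + j + 1) - 1"
      using that len l_def assms(2) by (simp add: dual_outer_def nth_tl)
    also have "lam ! (a + j + 1) = L (a + 1 + j + 1)"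
      using L[of "a + 1 + j + 1"] that l_def by simp
    finally have eq: "gamma a b (dual_outer lam) ! j = L (a + 1 + j + 1) - 1" .
    \<comment> \<open>Positivity of the outer part makes the truncated subtraction exact.\<close>
    have "K < L (a + 1 + j + 1)"
      by (rule K_less_L) (use that l_def in auto)
    then show ?thesis unfolding eq by simp
  qed
  have inner: "gamma a b (dual_inner mu) ! i = M (a + 1 + i)" if "i < l" for i
  proof -
    have "gamma a b (dual_inner mu) ! i = dual_inner mu ! (a + i)"
      by (rule gamma_nth) (use that len l_def in auto)
    also have "\<dots> = mu ! (a + i)"
      using that len l_def assms(4) by (simp add: dual_inner_def nth_butlast)
    also have "\<dots> = M (a + 1 + i)"
      using M[of "a + 1 + i"] that l_def by simp
    finally show ?thesis .
  qed
  have "f_det (gamma a b (dual_outer lam)) (gamma a b (dual_inner mu)) = row_det (a + 1) l"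
    unfolding f_det_def row_det_def len_gamma
    by (rule arg_cong[where f = det], rule eq_matI) (simp_all add: outer inner del: One_nat_def)
  moreover have "paths (a + 1) (m - b, 1) = row_det (a + 1) l"
    unfolding l_def using True ab K_less_m by (intro paths_first_column M_bottom) auto
  ultimately show ?thesis
    using True len by (simp add: f_gamma_def)
next
  case False
  then have "m - b < a + 1" "m - 1 < a + b"
    using ab K_less_m by linarith+
  then show ?thesis
    using paths_eq_0[of "(m - b, 1)" "a + 1"] assms(2) by (simp add: f_gamma_def dual_outer_def)
qed

section \<open>Nonintersecting paths\<close>

text \<open>Numbers the diagonals: an up step and a right step both raise it by 1. The shift by
  \<open>m\<close> keeps the subtraction exact on the region.\<close>

definition layer :: "nat \<times> nat \<Rightarrow> nat" where
  "layer x = snd x + m - fst x"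

text \<open>The diagonal of \<open>(K, n)\<close>, where only the rows 1 to \<open>K\<close> occur;
  it mirrors layer \<open>K\<close>, the diagonal of \<open>(m, K)\<close>.\<close>

definition last_layer :: nat where
  "last_layer = n + m - K"

definition moves :: "nat \<times> nat \<Rightarrow> (nat \<times> nat) set" where
  "moves x = {(fst x - 1, snd x), (fst x, Suc (snd x))} \<inter> R"

text \<open>Decreasing rows select one ordering of each set of \<open>K\<close> boxes on a diagonal,
  and extensionality makes the tuple unique.\<close>

definition tuples :: "nat \<Rightarrow> (nat \<Rightarrow> nat \<times> nat) set" where
  "tuples t = {p \<in> {..<K} \<rightarrow>\<^sub>E {x \<in> R. layer x = t}. \<forall>i j. i < j \<longrightarrow> j < K \<longrightarrow> fst (p j) < fst (p i)}"

definition succs :: "(nat \<Rightarrow> nat \<times> nat) \<Rightarrow> (nat \<Rightarrow> nat \<times> nat) set" where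
  "succs p = {q \<in> PiE {..<K} (\<lambda>i. moves (p i)). inj_on q {..<K}}"

definition families :: "nat \<Rightarrow> (nat \<Rightarrow> nat \<times> nat) \<Rightarrow> (nat \<Rightarrow> nat \<times> nat) list set" where
  "families l p = {ps. length ps = Suc l \<and> ps ! 0 = p \<and> (\<forall>s<l. ps ! Suc s \<in> succs (ps ! s))}"

lemma layer_inj: "x \<in> R \<Longrightarrow> y \<in> R \<Longrightarrow> layer x = layer y \<Longrightarrow> fst x = fst y \<Longrightarrow> x = y"
  by (cases x; cases y) (auto simp: layer_def)

lemma moves_cases:
  assumes "x \<in> R" "y \<in> moves x"
  shows "y \<in> R" "layer y = Suc (layer x)" "fst y = fst x \<or> Suc (fst y) = fst x"
  using assms by (auto simp: moves_def layer_def)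

lemma moves_iff:
  assumes "x \<in> R"
  shows "y \<in> moves x \<longleftrightarrow> y \<in> R \<and> layer y = Suc (layer x) \<and> (fst y = fst x \<or> Suc (fst y) = fst x)"
proof
  show "y \<in> R \<and> layer y = Suc (layer x) \<and> (fst y = fst x \<or> Suc (fst y) = fst x)" if "y \<in> moves x"
    using moves_cases[OF assms that] by simp
next
  assume "y \<in> R \<and> layer y = Suc (layer x) \<and> (fst y = fst x \<or> Suc (fst y) = fst x)"
  then show "y \<in> moves x"
    using assms by (cases x; cases y) (auto simp: moves_def layer_def)
qed

text \<open>Each row index drops by at most 1, so strict inequalities become at worst equalities,
  and an equality would make two boxes of one layer coincide. Paths therefore cannot change their
  order without meeting.\<close>

lemma succs_tuples:
  assumes p: "p \<in> tuples t" and q: "q \<in> succs p"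
  shows "q \<in> tuples (Suc t)"
proof -
  have pR: "p i \<in> R" "layer (p i) = t" if "i < K" for i
    using p that by (auto simp: tuples_def PiE_iff)
  have qi: "q i \<in> R" "layer (q i) = Suc t" "fst (q i) = fst (p i) \<or> Suc (fst (q i)) = fst (p i)"
    if "i < K" for i
    using moves_cases[of "p i" "q i"] pR[OF that] q that by (auto simp: succs_def PiE_iff)
  have "fst (q j) < fst (q i)" if "i < j" "j < K" for i j
  proof -
    have "fst (p j) < fst (p i)"
      using p that by (auto simp: tuples_def)
    then have "fst (q j) \<le> fst (q i)"
      using qi(3)[of i] qi(3)[of j] that by linarith
    moreover have "fst (q j) \<noteq> fst (q i)"
    proof
      assume "fst (q j) = fst (q i)"
      then have "q j = q i"
        using qi[of i] qi[of j] that by (intro layer_inj) auto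
      then show False
        using q that inj_onD[of q "{..<K}" j i] by (simp add: succs_def)
    qed
    ultimately show ?thesis by simp
  qed
  then show ?thesis
    using q qi by (auto simp: tuples_def succs_def PiE_iff)
qed

lemma finite_succs: "finite (succs p)"
proof -
  have "finite (PiE {..<K} (\<lambda>i. moves (p i)))"
    by (rule finite_PiE) (auto simp: moves_def)
  then show ?thesis
    by (rule rev_finite_subset) (auto simp: succs_def)
qed

lemma families_0: "families 0 p = {[p]}"
  by (auto simp: families_def length_Suc_conv)

lemma families_Suc: "families (Suc l) p = (\<Union>q\<in>succs p. (#) p ` families l q)"
proof (intro Set.set_eqI iffI)
  fix ps assume "ps \<in> families (Suc l) p"
  then have ps: "length ps = Suc (Suc l)" "ps ! 0 = p" "\<And>s. s < Suc l \<Longrightarrow> ps ! Suc s \<in> succs (ps ! s)"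
    by (auto simp: families_def)
  then obtain qs where qs: "ps = p # qs"
    by (cases ps) auto
  have "qs ! Suc s \<in> succs (qs ! s)" if "s < l" for s
    using ps(3)[of "Suc s"] qs that by simp
  then have "qs \<in> families l (qs ! 0)"
    using ps(1) qs by (simp add: families_def)
  moreover have "qs ! 0 \<in> succs p"
    using ps(3)[of 0] qs by simp
  ultimately show "ps \<in> (\<Union>q\<in>succs p. (#) p ` families l q)"
    using qs by blast
next
  fix ps assume "ps \<in> (\<Union>q\<in>succs p. (#) p ` families l q)"
  then show "ps \<in> families (Suc l) p"
    by (auto simp: families_def less_Suc_eq_0_disj)
qed

lemma finite_families: "finite (families l p)"
  by (induction l arbitrary: p) (auto simp: families_0 families_Suc finite_succs)

lemma card_families_Suc: "card (families (Suc l) p) = (\<Sum>q\<in>succs p. card (families l q))"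
proof -
  have "card (families (Suc l) p) = (\<Sum>q\<in>succs p. card ((#) p ` families l q))"
    unfolding families_Suc
    by (rule card_UN_disjoint) (simp add: finite_succs, simp add: finite_families, auto simp: families_def)
  also have "\<dots> = (\<Sum>q\<in>succs p. card (families l q))"
    by (rule sum.cong) (auto intro!: card_image)
  finally show ?thesis .
qed

lemma tuples_D:
  assumes "p \<in> tuples t"
  shows "i < K \<Longrightarrow> p i \<in> R" "i < K \<Longrightarrow> layer (p i) = t"
    and "i < j \<Longrightarrow> j < K \<Longrightarrow> fst (p j) < fst (p i)"
  using assms by (auto simp: tuples_def PiE_iff)

text \<open>Columns are at most \<open>n\<close>, which leaves only the rows 1 to \<open>K\<close>
  on this layer, so \<open>K\<close> boxes occupy all of them.\<close>

lemma last_layer_row: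
  assumes "p \<in> tuples last_layer" "i < K"
  shows "fst (p i) = K - i"
proof (rule strict_antimono_on_eq_diff)
  note p = tuples_D[OF assms(1)]
  show "fst (p j) < fst (p i)" if "i < j" "j < K" for i j
    using p(3) that .
  show "1 \<le> fst (p i) \<and> fst (p i) \<le> K" if "i < K" for i
    using p(1,2)[OF that] L_le_n[of "fst (p i)"] K_less_m M_top
    by (cases "p i") (auto simp: layer_def last_layer_def)
qed fact

text \<open>Box \<open>i\<close> already lies in the target row \<open>K - i\<close>, giving 1 on
  the matrix diagonal; for \<open>j < i\<close> it lies above row \<open>K - j\<close>, giving
  0.\<close>

lemma det_paths_last_layer:
  assumes "p \<in> tuples last_layer"
  shows "det (mat K K (\<lambda>(i, j). paths (K - j) (p i))) = 1"
proof -
  note p = tuples_D(1)[OF assms] and row = last_layer_row[OF assms]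
  show ?thesis
  proof (rule det_upper_unitriangular)
    show "paths (K - i) (p i) = 1" if "i < K" for i
      using row[OF that] p[OF that] paths_row[of "K - i" "snd (p i)"] by (metis prod.collapse)
    show "paths (K - j) (p i) = 0" if "j < i" "i < K" for i j
      using row[of i] that by (intro paths_eq_0) auto
  qed
qed

text \<open>Since two equal rows make the determinant vanish, multilinearity in the rows performs the
  sign-reversing cancellation of intersecting paths one layer at a time.\<close>

lemma det_paths_tuple:
  assumes "p \<in> tuples t" "t + l = last_layer"
  shows "det (mat K K (\<lambda>(i, j). paths (K - j) (p i))) = int (card (families l p))"
  using assms
proof (induction l arbitrary: p t)
  case 0
  then show ?case
    by (simp add: det_paths_last_layer families_0)
next
  case (Suc l)
  let ?det = "\<lambda>q. det (mat K K (\<lambda>(i, j). paths (K - j) (q i)))"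
  have p: "p i \<in> R" "layer (p i) = t" if "i < K" for i
    using Suc.prems that by (auto simp: tuples_def PiE_iff)
  have "paths (K - j) (p i) = (\<Sum>x\<in>moves (p i). paths (K - j) x)" if "i < K" "j < K" for i j
  proof -
    obtain r c where rc: "p i = (r, c)" by force
    have "paths (K - j) (r, c) = paths (K - j) (r - 1, c) + paths (K - j) (r, Suc c)"
    proof (rule paths_step)
      \<comment> \<open>The exceptional box \<open>(K - j, n)\<close> is on layer
        \<open>last_layer + j\<close>, whereas \<open>t < last_layer\<close> here.\<close>
      show "(r, c) \<noteq> (K - j, n)"
        using p(2)[OF \<open>i < K\<close>] rc Suc.prems(2) that by (auto simp: layer_def last_layer_def)
    qed (use p(1)[OF \<open>i < K\<close>] rc that in auto)
    also have "\<dots> = (\<Sum>x\<in>{(r - 1, c), (r, Suc c)}. paths (K - j) x)"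
      by simp
    also have "\<dots> = (\<Sum>x\<in>moves (p i). paths (K - j) x)"
      by (rule sum.mono_neutral_right) (use rc paths_eq_0 in \<open>auto simp: moves_def\<close>)
    finally show ?thesis using rc by simp
  qed
  then have "mat K K (\<lambda>(i, j). paths (K - j) (p i)) =
      mat K K (\<lambda>(i, j). \<Sum>x\<in>moves (p i). paths (K - j) x)"
    by (intro eq_matI) auto
  then have "?det p = (\<Sum>q\<in>PiE {..<K} (\<lambda>i. moves (p i)). ?det q)"
    by (simp add: det_sum_rows moves_def)
  also have "\<dots> = (\<Sum>q\<in>succs p. ?det q)"
  proof (rule sum.mono_neutral_right)
    show "finite (PiE {..<K} (\<lambda>i. moves (p i)))"
      by (rule finite_PiE) (auto simp: moves_def)
    show "\<forall>q \<in> PiE {..<K} (\<lambda>i. moves (p i)) - succs p. ?det q = 0"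
    proof
      fix q assume "q \<in> PiE {..<K} (\<lambda>i. moves (p i)) - succs p"
      then obtain i j where "i < K" "j < K" "i \<noteq> j" "q i = q j"
        by (auto simp: succs_def inj_on_def)
      then show "?det q = 0"
        by (intro det_identical_rows[of _ K i j]) auto
    qed
  qed (auto simp: succs_def)
  also have "\<dots> = (\<Sum>q\<in>succs p. int (card (families l q)))"
    using Suc.prems succs_tuples[OF Suc.prems(1)] by (intro sum.cong refl Suc.IH[of _ "Suc t"]) auto
  finally show ?case
    by (simp add: card_families_Suc)
qed

section \<open>The starting tuple and the number of path families\<close>

definition start :: "nat \<Rightarrow> nat \<times> nat" where
  "start = (\<lambda>i\<in>{..<K}. (m - i, K - i))"

lemma start_tuples: "start \<in> tuples K"
proof -
  have "(m - i, K - i) \<in> R" if "i < K" for i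
  proof -
    have "K < L (m - i)"
      using that K_less_m by (intro K_less_L) auto
    then show ?thesis
      using that K_less_m M_bottom[of "m - i"] by auto
  qed
  then show ?thesis
    using K_less_m by (auto simp: tuples_def start_def PiE_iff layer_def)
qed

lemma det_paths_eq_card_families:
  "det (mat K K (\<lambda>(i, j). paths (K - j) (m - i, 1))) = int (card (families (last_layer - K) start))"
proof -
  have "mat K K (\<lambda>(i, j). paths (K - j) (m - i, K - i)) = mat K K (\<lambda>(i, j). paths (K - j) (start i))"
    by (rule eq_matI) (auto simp: start_def)
  then show ?thesis
    unfolding det_paths_first_column
    using det_paths_tuple[OF start_tuples, of "last_layer - K"] K_less_m M_top
    by (simp add: last_layer_def)
qed

section \<open>Ones on diagonals\<close>

definition diag :: "nat \<Rightarrow> (nat \<times> nat) set" where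
  "diag t = {x \<in> R. layer x = t}"

definition ones :: "(nat \<times> nat \<Rightarrow> nat) \<Rightarrow> nat \<Rightarrow> (nat \<times> nat) set" where
  "ones F t = {x \<in> diag t. F x = 1}"

lemma finite_R: "finite R"
proof (rule finite_subset)
  show "R \<subseteq> {..m} \<times> {..n}"
    using L_le_n by (force simp: R_def intro: le_trans)
qed simp

lemma finite_diag: "finite (diag t)"
  using finite_R by (simp add: diag_def)

text \<open>\<open>M r <= M (fst x) < snd x <= c <= snd y <= L (fst y) <= L r\<close>, as both
  boundaries are weakly decreasing. A chain thus spans a rectangle inside the region as soon as its
  two ends lie in it.\<close>

lemma R_convex:
  assumes "x \<in> R" "y \<in> R" "fst x \<le> r" "r \<le> fst y" "snd x \<le> c" "c \<le> snd y"
  shows "(r, c) \<in> R"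
  using assms L_antimono[of r "fst y"] M_antimono[of "fst x" r]
  by (cases x; cases y) auto

lemma layer_eq: "x \<in> R \<Longrightarrow> int (layer x) = int (snd x) + int m - int (fst x)"
  by (cases x) (auto simp: layer_def)

lemma fst_less_iff_snd_less:
  assumes "x \<in> R" "y \<in> R" "layer x = layer y"
  shows "fst x < fst y \<longleftrightarrow> snd x < snd y"
  using layer_eq[OF assms(1)] layer_eq[OF assms(2)] assms(3) by linarith

lemma inj_on_fst_diag: "inj_on fst (diag t)"
  by (rule inj_onI) (simp add: diag_def layer_inj)

text \<open>By \<open>R_convex\<close> the rectangle condition follows from the ends
  \<open>y K\<close> and \<open>y 0\<close>, so only a chain of ones remains. Indices start with 0
  at the lower right end, to match \<open>tuples\<close>.\<close>

lemma contains_I_iff_antimono: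
  "contains_I R (Suc K) F \<longleftrightarrow> (\<exists>y. (\<forall>i\<le>K. y i \<in> R \<and> F (y i) = 1) \<and>
     (\<forall>i j. i < j \<longrightarrow> j \<le> K \<longrightarrow> fst (y j) < fst (y i) \<and> snd (y j) < snd (y i)))"
    (is "_ \<longleftrightarrow> (\<exists>y. ?P y)")
proof
  assume "contains_I R (Suc K) F"
  then obtain r c where rc: "strict_mono_on {1..Suc K} r" "strict_mono_on {1..Suc K} c"
    "\<forall>i \<in> {1..Suc K}. \<forall>j \<in> {1..Suc K}. (r i, c j) \<in> R"
    "\<forall>i \<in> {1..Suc K}. F (r i, c i) = 1"
    unfolding contains_I_def by (elim exE conjE) (rule that)
  have "?P (\<lambda>i. (r (Suc K - i), c (Suc K - i)))"
  proof (intro conjI allI impI)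
    fix i j assume "i < j" "j \<le> K"
    then have "Suc K - j \<in> {1..Suc K}" "Suc K - i \<in> {1..Suc K}" "Suc K - j < Suc K - i" by auto
    note * = this
    show "fst (r (Suc K - j), c (Suc K - j)) < fst (r (Suc K - i), c (Suc K - i))"
      unfolding fst_conv by (rule strict_mono_onD[OF rc(1) *])
    show "snd (r (Suc K - j), c (Suc K - j)) < snd (r (Suc K - i), c (Suc K - i))"
      unfolding snd_conv by (rule strict_mono_onD[OF rc(2) *])
  next
    fix i assume "i \<le> K"
    then have *: "Suc K - i \<in> {1..Suc K}" by auto
    show "(r (Suc K - i), c (Suc K - i)) \<in> R"
      by (rule rc(3)[rule_format, OF * *])
    show "F (r (Suc K - i), c (Suc K - i)) = 1"
      by (rule rc(4)[rule_format, OF *])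
  qed
  then show "\<exists>y. ?P y"
    by (intro exI[of _ "\<lambda>i. (r (Suc K - i), c (Suc K - i))"])
next
  assume "\<exists>y. ?P y"
  then obtain y where "?P y" by (elim exE)
  then have y: "\<And>i. i \<le> K \<Longrightarrow> y i \<in> R" "\<And>i. i \<le> K \<Longrightarrow> F (y i) = 1"
    "\<And>i j. i < j \<Longrightarrow> j \<le> K \<Longrightarrow> fst (y j) < fst (y i)"
    "\<And>i j. i < j \<Longrightarrow> j \<le> K \<Longrightarrow> snd (y j) < snd (y i)" by simp_all
  have le: "fst (y j) \<le> fst (y i)" "snd (y j) \<le> snd (y i)" if "i \<le> j" "j \<le> K" for i j
    using y(3,4)[of i j] that by (cases "i = j"; simp)+
  have "(fst (y (Suc K - i)), snd (y (Suc K - j))) \<in> R" if "i \<in> {1..Suc K}" "j \<in> {1..Suc K}" for i j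
  proof (rule R_convex[OF y(1)[of K] y(1)[of 0]])
    show "fst (y K) \<le> fst (y (Suc K - i))" "snd (y K) \<le> snd (y (Suc K - j))"
      "fst (y (Suc K - i)) \<le> fst (y 0)" "snd (y (Suc K - j)) \<le> snd (y 0)"
      by (rule le; use that in auto)+
  qed auto
  moreover have "strict_mono_on {1..Suc K} (\<lambda>i. fst (y (Suc K - i)))"
    "strict_mono_on {1..Suc K} (\<lambda>i. snd (y (Suc K - i)))"
    by (rule strict_mono_onI, rule y, force, force)+
  moreover have "F (fst (y (Suc K - i)), snd (y (Suc K - i))) = 1" if "i \<in> {1..Suc K}" for i
    using y(2)[of "Suc K - i"] that by auto
  ultimately show "contains_I R (Suc K) F"
    unfolding contains_I_def
    by (intro exI[of _ "\<lambda>i. fst (y (Suc K - i))"] exI[of _ "\<lambda>i. snd (y (Suc K - i))"] conjI ballI)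
qed

lemma tuple_exists:
  assumes "A \<subseteq> diag t" "card A = N"
  shows "\<exists>y. (\<forall>i j. i < j \<longrightarrow> j < N \<longrightarrow> fst (y j) < fst (y i)) \<and> y ` {..<N} = A"
proof -
  have inj: "inj_on fst A"
    using inj_on_fst_diag assms(1) by (rule inj_on_subset)
  have "finite (fst ` A)" "card (fst ` A) = N"
    using assms(2) card_image[OF inj] finite_subset[OF assms(1) finite_diag] by auto
  then obtain f where f: "\<And>i j. i < j \<Longrightarrow> j < N \<Longrightarrow> f j < f i" "f ` {..<N} = fst ` A"
    using ex_strict_antimono_enumeration by blast
  define y where "y = (\<lambda>i. inv_into A fst (f i))"
  have fst_y: "fst (y i) = f i" if "i < N" for i
    using that f(2) unfolding y_def by (intro f_inv_into_f) auto
  have "y ` {..<N} = inv_into A fst ` fst ` A"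
    unfolding y_def f(2)[symmetric] by (simp add: image_image)
  then have "y ` {..<N} = A"
    using inj by (simp add: image_image)
  then show ?thesis
    using f(1) fst_y by (intro exI[of _ y]) simp
qed

lemma card_ones_le_K:
  assumes "\<not> contains_I R (Suc K) F"
  shows "card (ones F t) \<le> K"
proof (rule ccontr)
  assume "\<not> card (ones F t) \<le> K"
  then obtain A where A: "A \<subseteq> ones F t" "card A = Suc K"
    by (metis obtain_subset_with_card_n not_less_eq_eq)
  then have "A \<subseteq> diag t" by (auto simp: ones_def)
  from tuple_exists[OF this A(2)] obtain y
    where y: "\<forall>i j. i < j \<longrightarrow> j < Suc K \<longrightarrow> fst (y j) < fst (y i)" "y ` {..<Suc K} = A"
    by (elim exE conjE) (rule that)
  have yR: "y i \<in> R \<and> layer (y i) = t \<and> F (y i) = 1" if "i \<le> K" for i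
  proof -
    have "y i \<in> ones F t"
      using that A(1) unfolding y(2)[symmetric] by auto
    then show ?thesis by (simp add: ones_def diag_def)
  qed
  have fst_y: "fst (y j) < fst (y i)" if "i < j" "j \<le> K" for i j
    using y(1) that by simp
  have snd_y: "snd (y j) < snd (y i)" if "i < j" "j \<le> K" for i j
    using fst_less_iff_snd_less[of "y j" "y i"] yR[of i] yR[of j] fst_y[OF that] that by simp
  have "contains_I R (Suc K) F"
    unfolding contains_I_iff_antimono
    by (intro exI[of _ y] conjI allI impI) (simp_all only: yR fst_y snd_y)
  then show False using assms by simp
qed

text \<open>The box tested lies \<open>K\<close> steps up and left on the same diagonal, so the ones
  are the first \<open>K\<close> boxes of each diagonal, or all of them if there are fewer.\<close>

definition first_boxes :: "nat \<times> nat \<Rightarrow> nat" where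
  "first_boxes = (\<lambda>x\<in>R. if \<exists>y\<in>R. fst x = fst y + K \<and> snd x = snd y + K then 0 else 1)"

text \<open>In a chain of \<open>K + 1\<close> ones, \<open>y 0\<close> exceeds \<open>y K\<close>
  by at least \<open>K\<close> in both coordinates. Convexity puts the box \<open>K\<close> steps
  back from \<open>y 0\<close> into the region, so \<open>y 0\<close> carries 0.\<close>

lemma first_boxes_avoiding: "first_boxes \<in> avoiding_fillings R (Suc K)"
proof -
  have "\<not> contains_I R (Suc K) first_boxes"
  proof
    assume "contains_I R (Suc K) first_boxes"
    then obtain y where y: "\<And>i. i \<le> K \<Longrightarrow> y i \<in> R \<and> first_boxes (y i) = 1"
      "\<And>i j. i < j \<Longrightarrow> j \<le> K \<Longrightarrow> fst (y j) < fst (y i) \<and> snd (y j) < snd (y i)"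
      unfolding contains_I_iff_antimono by blast
    have "fst (y K) + K \<le> fst (y 0)" "snd (y K) + K \<le> snd (y 0)"
      using y(2) by (auto intro!: antimono_diff_le[of K "\<lambda>i. fst (y i)"] antimono_diff_le[of K "\<lambda>i. snd (y i)"])
    moreover from this have "(fst (y 0) - K, snd (y 0) - K) \<in> R"
      using y(1)[of 0] y(1)[of K] by (intro R_convex[of "y K" "y 0"]) auto
    ultimately have "\<exists>z\<in>R. fst (y 0) = fst z + K \<and> snd (y 0) = snd z + K"
      by (intro bexI[of _ "(fst (y 0) - K, snd (y 0) - K)"]) auto
    then have "first_boxes (y 0) = 0"
      using y(1)[of 0] by (simp only: first_boxes_def restrict_apply if_True)
    then show False
      using y(1)[of 0] by simp
  qed
  then show ?thesis
    by (auto simp: avoiding_fillings_def fillings_def first_boxes_def PiE_iff)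
qed

lemma card_diag: "card (fst ` diag t) = card (diag t)"
  by (rule card_image[OF inj_on_fst_diag])

lemma card_ones_first_boxes: "min K (card (diag t)) \<le> card (ones first_boxes t)"
proof (cases "diag t = {}")
  case False
  let ?A = "fst ` diag t"
  have fin: "finite ?A" "?A \<noteq> {}"
    using finite_diag False by auto
  define a where "a = Min ?A"
  define b where "b = Max ?A"
  obtain x where x: "x \<in> diag t" "fst x = a"
    using Min_in[OF fin] unfolding a_def by auto
  obtain z where z: "z \<in> diag t" "fst z = b"
    using Max_in[OF fin] unfolding b_def by auto
  have A: "?A \<subseteq> {a..b}"
    using Min_le[OF fin(1)] Max_ge[OF fin(1)] unfolding a_def b_def atLeastAtMost_def by blast
  \<comment> \<open>By convexity every row from \<open>a\<close> to \<open>b\<close> meets the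
    diagonal; in the first \<open>K\<close> of these rows a box \<open>K\<close> steps back would
    lie above the topmost row \<open>a\<close>.\<close>
  have "{a..min b (a + K - 1)} \<subseteq> fst ` ones first_boxes t"
  proof
    fix r assume r: "r \<in> {a..min b (a + K - 1)}"
    let ?y = "(r, snd x + (r - a))"
    have "?y \<in> R"
      using x z r layer_eq[of x] layer_eq[of z] by (intro R_convex[of x z]) (auto simp: diag_def)
    then have y: "?y \<in> diag t"
      using x r layer_eq[of x] layer_eq[of ?y] by (auto simp: diag_def simp del: mem_R)
    have "fst ?y \<noteq> fst w + K \<or> snd ?y \<noteq> snd w + K" if "w \<in> R" for w
    proof (rule ccontr)
      assume *: "\<not> (fst ?y \<noteq> fst w + K \<or> snd ?y \<noteq> snd w + K)"
      then have "w \<in> diag t"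
        using y that layer_eq[OF that] layer_eq[OF \<open>?y \<in> R\<close>] by (auto simp: diag_def simp del: mem_R)
      then have "a \<le> fst w"
        using A by auto
      then show False using * r K_pos by auto
    qed
    then have "first_boxes ?y = 1"
      using \<open>?y \<in> R\<close> unfolding first_boxes_def by auto
    then show "r \<in> fst ` ones first_boxes t"
      using y by (force simp: ones_def)
  qed
  then have "card {a..min b (a + K - 1)} \<le> card (fst ` ones first_boxes t)"
    using finite_diag by (intro card_mono) (auto simp: ones_def)
  also have "\<dots> \<le> card (ones first_boxes t)"
    using finite_diag by (intro card_image_le) (auto simp: ones_def)
  finally have "card {a..min b (a + K - 1)} \<le> card (ones first_boxes t)" .
  moreover have "card (diag t) \<le> card {a..b}"
    unfolding card_diag[symmetric] by (rule card_mono) (use A in auto)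
  ultimately show ?thesis
    using K_pos by (auto simp: min_def split: if_splits)
qed auto

section \<open>Maximality, diagonal by diagonal\<close>

lemma layer_le: "x \<in> R \<Longrightarrow> layer x \<le> n + m"
  using L_le_n[of "fst x"] by (cases x) (auto simp: layer_def)

lemma num_ones_eq_sum: "num_ones R F = (\<Sum>t\<le>n + m. card (ones F t))"
proof -
  have "{x \<in> R. F x = 1} = (\<Union>t\<in>{..n + m}. ones F t)"
    using layer_le by (auto simp: ones_def diag_def simp del: mem_R)
  then show ?thesis
    unfolding num_ones_def
    by (simp only:) (rule card_UN_disjoint; auto simp: ones_def diag_def finite_R)
qed

lemma card_ones_le: "\<not> contains_I R (Suc K) F \<Longrightarrow> card (ones F t) \<le> min K (card (diag t))"
  using card_ones_le_K[of F t] card_mono[OF finite_diag, of "ones F t" t] by (auto simp: ones_def)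

text \<open>\<open>first_boxes\<close> attains the upper bound on all diagonals at once, so the
  maximal total is the sum of the bounds, and a total of this size forces equality in every
  summand.\<close>

lemma maximal_fillings_eq:
  "maximal_fillings R (Suc K) =
     {F \<in> avoiding_fillings R (Suc K). \<forall>t. card (ones F t) = min K (card (diag t))}"
proof (intro equalityI subsetI)
  fix F assume F: "F \<in> maximal_fillings R (Suc K)"
  then have avoid: "F \<in> avoiding_fillings R (Suc K)" and le: "num_ones R first_boxes \<le> num_ones R F"
    using first_boxes_avoiding by (simp_all add: maximal_fillings_def)
  have ub: "card (ones F t) \<le> min K (card (diag t))" for t
    using avoid card_ones_le[of F t] by (simp add: avoiding_fillings_def)
  have sum_le: "(\<Sum>t\<le>n + m. card (ones F t)) \<le> (\<Sum>t\<le>n + m. min K (card (diag t)))"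
    using ub by (rule sum_mono)
  have "(\<Sum>t\<le>n + m. min K (card (diag t))) \<le> (\<Sum>t\<le>n + m. card (ones first_boxes t))"
    by (rule sum_mono) (rule card_ones_first_boxes)
  also have "\<dots> \<le> (\<Sum>t\<le>n + m. card (ones F t))"
    using le by (simp add: num_ones_eq_sum)
  finally have "(\<Sum>t\<le>n + m. card (ones F t)) = (\<Sum>t\<le>n + m. min K (card (diag t)))"
    using sum_le by simp
  then have inside: "card (ones F t) = min K (card (diag t))" if "t \<le> n + m" for t
    by (rule sum_mono_inv) (use ub that in simp_all)
  have "card (ones F t) = min K (card (diag t))" for t
  proof (cases "t \<le> n + m")
    case False
    then have "diag t = {}"
      using layer_le by (auto simp: diag_def simp del: mem_R)
    then show ?thesis by (simp add: ones_def)
  qed (rule inside)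
  then show "F \<in> {F \<in> avoiding_fillings R (Suc K). \<forall>t. card (ones F t) = min K (card (diag t))}"
    using avoid by simp
next
  fix F assume F: "F \<in> {F \<in> avoiding_fillings R (Suc K). \<forall>t. card (ones F t) = min K (card (diag t))}"
  have "num_ones R G \<le> num_ones R F" if "G \<in> avoiding_fillings R (Suc K)" for G
    unfolding num_ones_eq_sum
  proof (rule sum_mono)
    fix t
    show "card (ones G t) \<le> card (ones F t)"
      using card_ones_le[of G t] that F by (simp add: avoiding_fillings_def)
  qed
  then show "F \<in> maximal_fillings R (Suc K)"
    using F by (simp add: maximal_fillings_def)
qed

text \<open>Positive columns leave only the last \<open>t\<close> rows on an early diagonal, and
  columns at most \<open>n\<close> leave only the first \<open>K\<close> rows on a late one.\<close>

lemma card_diag_le_K: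
  assumes "t \<le> K \<or> last_layer \<le> t"
  shows "card (diag t) \<le> K"
proof -
  have "fst ` diag t \<subseteq> (if t \<le> K then {m - t<..m} else {1..K})"
  proof
    fix r assume "r \<in> fst ` diag t"
    then obtain c where rc: "(r, c) \<in> R" "layer (r, c) = t"
      by (auto simp: diag_def simp del: mem_R)
    then show "r \<in> (if t \<le> K then {m - t<..m} else {1..K})"
      using assms L_le_n[of r] K_less_m M_top by (auto simp: layer_def last_layer_def)
  qed
  then have "card (fst ` diag t) \<le> card (if t \<le> K then {m - t<..m} else {1..K})"
    by (rule card_mono[rotated]) auto
  also have "\<dots> \<le> K" by auto
  finally show ?thesis by (simp add: card_diag)
qed

text \<open>Before \<open>last_layer\<close> a box in row 1 can move right. A box in another row
  without a move would give \<open>L r <= M (r - 1)\<close>, against \<open>thick\<close>, or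
  against \<open>M_bottom\<close> near the bottom.\<close>

lemma diag_nonempty_Suc:
  assumes "diag t \<noteq> {}" "t < last_layer"
  shows "diag (Suc t) \<noteq> {}"
proof -
  obtain r c where rc: "(r, c) \<in> R" "layer (r, c) = t"
    using assms(1) by (auto simp: diag_def simp del: mem_R)
  have "moves (r, c) \<noteq> {}"
  proof (cases "r = 1")
    case True
    then have "c < n"
      using rc assms(2) K_pos K_less_m M_top by (auto simp: layer_def last_layer_def)
    then show ?thesis
      using True rc L_top[of 1] K_pos by (auto simp: moves_def)
  next
    case False
    show ?thesis
    proof
      assume "moves (r, c) = {}"
      then have notin: "(r - 1, c) \<notin> R" "(r, Suc c) \<notin> R"
        by (auto simp: moves_def)
      have r: "2 \<le> r" using False rc(1) by simp
      then have "L r \<le> L (r - 1)"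
        using rc(1) by (intro L_antimono) auto
      then have c: "c = L r" "c \<le> M (r - 1)"
        using r notin rc(1) by auto
      show False
      proof (cases "r - 1 + K \<le> m")
        case True
        have "M (r - 1) + K \<le> L (r - 1 + K)"
          by (rule thick) (use True r in auto)
        also have "\<dots> \<le> L r"
          by (rule L_antimono) (use True r K_pos in auto)
        finally show ?thesis
          using c K_pos by simp
      next
        case F: False
        have "M (r - 1) = 0"
          by (rule M_bottom) (use F rc(1) in auto)
        then show ?thesis
          using c rc(1) by simp
      qed
    qed
  qed
  then show ?thesis
    using moves_cases[OF rc(1)] rc(2) by (auto simp: diag_def simp del: mem_R)
qed

lemma K_le_card_diag:
  assumes "K \<le> t" "t \<le> last_layer"
  shows "K \<le> card (diag t)"
proof -
  have "start 0 \<in> diag K"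
    using tuples_D(1,2)[OF start_tuples, of 0] K_pos by (simp add: diag_def)
  then have diag_K: "diag K \<noteq> {}" by blast
  from assms have "diag t \<noteq> {}"
  proof (induction t rule: dec_induct)
    case base
    show ?case by (rule diag_K)
  next
    case (step t)
    then show ?case using diag_nonempty_Suc[of t] by simp
  qed
  then obtain x where "x \<in> diag t" "\<forall>y. y \<in> diag t \<longrightarrow> fst x \<le> fst y"
    using ex_has_least_nat[of "\<lambda>x. x \<in> diag t" _ fst] by blast
  moreover define r c where "r = fst x" and "c = snd x"
  ultimately have rc: "(r, c) \<in> R" "layer (r, c) = t"
    and least: "\<And>y. y \<in> diag t \<Longrightarrow> r \<le> fst y"
    by (simp_all add: diag_def del: mem_R split_paired_All)
  have not_R: "(r - 1, c - 1) \<notin> R" if "r \<noteq> 1" "c \<noteq> 1"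
  proof
    assume "(r - 1, c - 1) \<in> R"
    then have "(r - 1, c - 1) \<in> diag t"
      using rc that by (auto simp: diag_def layer_def)
    then show False using least rc by force
  qed
  \<comment> \<open>The topmost box \<open>(r, c)\<close> sits at the upper edge, at the left edge
    or at the inner boundary. In the first two cases the bounds on \<open>t\<close> and the wide
    corners give room for \<open>K\<close> boxes, in the third \<open>thick\<close> does.\<close>
  have last: "(r + (K - 1), c + (K - 1)) \<in> R"
  proof -
    consider "r = 1" | "r \<noteq> 1" "c = 1" | "r \<noteq> 1" "c \<noteq> 1" by blast
    then show ?thesis
    proof cases
      case 1
      then show ?thesis
        using rc assms K_less_m K_pos M_top L_top[of K] M_antimono[of 1 K]
        by (auto simp: layer_def last_layer_def)
    next
      case 2
      then have rm: "r + (K - 1) \<le> m"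
        using rc assms K_pos by (auto simp: layer_def)
      have "K < L (r + (K - 1))"
        by (rule K_less_L) (use rc rm in auto)
      moreover have "M (r + (K - 1)) \<le> M r"
        by (rule M_antimono) (use rc rm in auto)
      ultimately show ?thesis
        using 2 rc rm K_pos by auto
    next
      case 3
      then have r: "2 \<le> r" using rc(1) by simp
      then have "L r \<le> L (r - 1)"
        using rc(1) by (intro L_antimono) auto
      then have c: "c - 1 \<le> M (r - 1)"
        using not_R rc 3 r by auto
      have rK: "r - 1 + K \<le> m"
      proof (rule ccontr)
        assume "\<not> r - 1 + K \<le> m"
        then show False
          using M_bottom[of "r - 1"] c 3 rc by auto
      qed
      have "M (r - 1) + K \<le> L (r - 1 + K)"
        by (rule thick) (use rK r in auto)
      moreover have "r - 1 + K = r + (K - 1)" using r K_pos by auto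
      moreover have "M (r + (K - 1)) \<le> M r"
        by (rule M_antimono) (use rK r K_pos in linarith)+
      ultimately show ?thesis
        using c 3 rc rK K_pos r by auto
    qed
  qed
  have "{r..<r + K} \<subseteq> fst ` diag t"
  proof
    fix s assume s: "s \<in> {r..<r + K}"
    then have "(s, c + (s - r)) \<in> R"
      by (intro R_convex[OF rc(1) last]) auto
    then have "(s, c + (s - r)) \<in> diag t"
      using rc s by (auto simp: diag_def layer_def)
    then show "s \<in> fst ` diag t" by force
  qed
  then have "card {r..<r + K} \<le> card (fst ` diag t)"
    by (rule card_mono[rotated]) (simp add: finite_diag)
  then show ?thesis by (simp add: card_diag)
qed

section \<open>Maximal fillings as families of paths\<close>

text \<open>Follow \<open>z\<close> from its lower right end through index \<open>a\<close>, then
  switch to \<open>y\<close> from the same index \<open>a\<close> on: this takes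
  \<open>a + 1\<close> plus \<open>K - a\<close> boxes, one more than either chain has.\<close>

lemma contains_I_crossing:
  assumes y: "\<And>i. i < K \<Longrightarrow> y i \<in> R \<and> F (y i) = 1"
    "\<And>i j. i < j \<Longrightarrow> j < K \<Longrightarrow> fst (y j) < fst (y i) \<and> snd (y j) < snd (y i)"
    and z: "\<And>i. i < K \<Longrightarrow> z i \<in> R \<and> F (z i) = 1"
    "\<And>i j. i < j \<Longrightarrow> j < K \<Longrightarrow> fst (z j) < fst (z i) \<and> snd (z j) < snd (z i)"
    and a: "a < K" "fst (y a) < fst (z a)" "snd (y a) < snd (z a)"
  shows "contains_I R (Suc K) F"
proof -
  define w where "w = (\<lambda>i. if i \<le> a then z i else y (i - 1))"
  have w: "w i \<in> R \<and> F (w i) = 1" if "i \<le> K" for i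
    using that a(1) y(1)[of "i - 1"] z(1)[of i] by (auto simp: w_def)
  have step: "fst (w j) < fst (w i) \<and> snd (w j) < snd (w i)" if "i < j" "j \<le> K" for i j
  proof -
    have z_le: "fst (z a) \<le> fst (z i) \<and> snd (z a) \<le> snd (z i)" if "i \<le> a"
      using z(2)[of i a] a(1) that by (cases "i = a") auto
    have y_le: "fst (y (j - 1)) \<le> fst (y a) \<and> snd (y (j - 1)) \<le> snd (y a)" if "a < j"
    proof (cases "j - 1 = a")
      case False
      then have "a < j - 1" "j - 1 < K" using that \<open>j \<le> K\<close> by linarith+
      then show ?thesis using y(2)[of a "j - 1"] by simp
    qed simp
    consider "j \<le> a" | "i \<le> a" "a < j" | "a < i" using that by linarith
    then show ?thesis
    proof cases
      case 1
      then show ?thesis using z(2)[of i j] a(1) that by (simp add: w_def)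
    next
      case 2
      then show ?thesis using z_le y_le a by (simp add: w_def)
    next
      case 3
      then show ?thesis using y(2)[of "i - 1" "j - 1"] that by (simp add: w_def)
    qed
  qed
  show ?thesis
    unfolding contains_I_iff_antimono
    by (intro exI[of _ w] conjI allI impI) (simp_all only: w step)
qed

lemma tuples_snd:
  assumes "p \<in> tuples t" "i < j" "j < K"
  shows "snd (p j) < snd (p i)"
  using tuples_D[OF assms(1)] fst_less_iff_snd_less[of "p j" "p i"] assms(2,3) by simp

lemma tuples_inj_on:
  assumes "p \<in> tuples t"
  shows "inj_on p {..<K}"
proof (rule inj_onI)
  fix i j assume ij: "i \<in> {..<K}" "j \<in> {..<K}" "p i = p j"
  show "i = j"
  proof (cases i j rule: linorder_cases)
    case less
    then show ?thesis using tuples_D(3)[OF assms, of i j] ij by simp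
  next
    case greater
    then show ?thesis using tuples_D(3)[OF assms, of j i] ij by simp
  qed
qed

lemma avoiding_not_crossing:
  assumes avoid: "\<not> contains_I R (Suc K) F"
    and p: "p \<in> tuples t" "\<And>i. i < K \<Longrightarrow> F (p i) = 1"
    and q: "q \<in> tuples s" "\<And>i. i < K \<Longrightarrow> F (q i) = 1"
    and i: "i < K"
  shows "\<not> (fst (p i) < fst (q i) \<and> snd (p i) < snd (q i))"
proof
  assume "fst (p i) < fst (q i) \<and> snd (p i) < snd (q i)"
  then have less: "fst (p i) < fst (q i)" "snd (p i) < snd (q i)" by simp_all
  have "contains_I R (Suc K) F"
  proof (rule contains_I_crossing[where y = p and z = q and a = i])
    show "p j \<in> R \<and> F (p j) = 1" "q j \<in> R \<and> F (q j) = 1" if "j < K" for j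
      using tuples_D(1)[OF p(1) that] tuples_D(1)[OF q(1) that] p(2)[OF that] q(2)[OF that] by simp_all
    show "fst (p j) < fst (p l) \<and> snd (p j) < snd (p l)"
      "fst (q j) < fst (q l) \<and> snd (q j) < snd (q l)" if "l < j" "j < K" for j l
      using tuples_D(3)[OF p(1) that] tuples_snd[OF p(1) that]
        tuples_D(3)[OF q(1) that] tuples_snd[OF q(1) that] by simp_all
  qed (use i less in simp_all)
  then show False using avoid by simp
qed

text \<open>Between consecutive layers the column change exceeds the row change by 1. Excluding
  strict dominance in both directions leaves only the row changes 0 and -1, that is, a right step or
  an up step.\<close>

lemma avoiding_succs:
  assumes avoid: "\<not> contains_I R (Suc K) F"
    and p: "p \<in> tuples t" "\<And>i. i < K \<Longrightarrow> F (p i) = 1"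
    and q: "q \<in> tuples (Suc t)" "\<And>i. i < K \<Longrightarrow> F (q i) = 1"
  shows "q \<in> succs p"
proof -
  have "q i \<in> moves (p i)" if i: "i < K" for i
  proof -
    note pi = tuples_D(1,2)[OF p(1) i] and qi = tuples_D(1,2)[OF q(1) i]
    have "fst (q i) = fst (p i) \<or> Suc (fst (q i)) = fst (p i)"
      using avoiding_not_crossing[OF avoid p q i] avoiding_not_crossing[OF avoid q p i]
        layer_eq[OF pi(1)] layer_eq[OF qi(1)] pi(2) qi(2) by linarith
    then show ?thesis
      using moves_iff[OF pi(1)] pi(2) qi by simp
  qed
  then show ?thesis
    using q(1) tuples_inj_on[OF q(1)] by (simp add: succs_def tuples_def PiE_iff)
qed

lemma tuples_inj:
  assumes "p \<in> tuples t" "q \<in> tuples t" "p ` {..<K} = q ` {..<K}"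
  shows "p = q"
proof (rule extensionalityI)
  show "p \<in> extensional {..<K}" "q \<in> extensional {..<K}"
    using assms by (auto simp: tuples_def PiE_def)
  fix i assume "i \<in> {..<K}"
  then have i: "i < K" by simp
  have "fst (p i) = fst (q i)"
  proof (rule strict_antimono_on_unique[of K "\<lambda>i. fst (p i)" "\<lambda>i. fst (q i)"])
    show "(\<lambda>i. fst (p i)) ` {..<K} = (\<lambda>i. fst (q i)) ` {..<K}"
      using arg_cong[OF assms(3), of "(`) fst"] by (simp add: image_image)
  qed (use tuples_D(3)[OF assms(1)] tuples_D(3)[OF assms(2)] i in auto)
  then show "p i = q i"
    using tuples_D(1,2)[OF assms(1) i] tuples_D(1,2)[OF assms(2) i] by (intro layer_inj) auto
qed

lemma tuples_card_image: "p \<in> tuples t \<Longrightarrow> card (p ` {..<K}) = K"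
  using card_image[OF tuples_inj_on] by simp

lemma tuples_image_subset: "p \<in> tuples t \<Longrightarrow> p ` {..<K} \<subseteq> diag t"
  using tuples_D by (auto simp: diag_def simp del: mem_R)

lemma ex_tuple_image:
  assumes "A \<subseteq> diag t" "card A = K"
  shows "\<exists>p\<in>tuples t. p ` {..<K} = A"
proof -
  from tuple_exists[OF assms] obtain y
    where y: "\<forall>i j. i < j \<longrightarrow> j < K \<longrightarrow> fst (y j) < fst (y i)" "y ` {..<K} = A"
    by (elim exE conjE) (rule that)
  have "y i \<in> diag t" if "i < K" for i
    using assms(1) that unfolding y(2)[symmetric] by auto
  then have "restrict y {..<K} \<in> tuples t"
    using y(1) by (simp add: tuples_def diag_def)
  moreover have "restrict y {..<K} ` {..<K} = A"
    using y(2) by simp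
  ultimately show ?thesis by blast
qed

section \<open>The filling of a family of paths\<close>

definition path_families :: "(nat \<Rightarrow> nat \<times> nat) list set" where
  "path_families = families (last_layer - K) start"

lemma K_le_last_layer: "K \<le> last_layer"
  using K_less_m M_top by (simp add: last_layer_def)

lemma families_D:
  assumes "ps \<in> path_families"
  shows "length ps = Suc last_layer - K" "ps ! 0 = start"
    and "K \<le> t \<Longrightarrow> t < last_layer \<Longrightarrow> ps ! (Suc t - K) \<in> succs (ps ! (t - K))"
proof -
  show "length ps = Suc last_layer - K" "ps ! 0 = start"
    using assms K_le_last_layer by (auto simp: path_families_def families_def)
  show "ps ! (Suc t - K) \<in> succs (ps ! (t - K))" if "K \<le> t" "t < last_layer"
  proof -
    have "Suc t - K = Suc (t - K)" "t - K < last_layer - K" using that by auto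
    then show ?thesis
      using assms by (simp add: path_families_def families_def)
  qed
qed

lemma families_tuples:
  assumes "ps \<in> path_families" "K \<le> t" "t \<le> last_layer"
  shows "ps ! (t - K) \<in> tuples t"
  using assms(2,3)
proof (induction t rule: dec_induct)
  case base
  then show ?case using families_D(2)[OF assms(1)] start_tuples by simp
next
  case (step t)
  then show ?case
    using families_D(3)[OF assms(1), of t] succs_tuples[of "ps ! (t - K)" t] by simp
qed

text \<open>The implication turns every box before layer \<open>K\<close> or after
  \<open>last_layer\<close> into a one; those diagonals have at most \<open>K\<close> boxes.\<close>

definition family_ones :: "(nat \<Rightarrow> nat \<times> nat) list \<Rightarrow> (nat \<times> nat) set" where
  "family_ones ps = {x \<in> R. K \<le> layer x \<and> layer x \<le> last_layer \<longrightarrow>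
     x \<in> (ps ! (layer x - K)) ` {..<K}}"

definition family_filling :: "(nat \<Rightarrow> nat \<times> nat) list \<Rightarrow> nat \<times> nat \<Rightarrow> nat" where
  "family_filling ps = (\<lambda>x\<in>R. if x \<in> family_ones ps then 1 else 0)"

lemma family_filling_eq_1: "x \<in> R \<Longrightarrow> family_filling ps x = 1 \<longleftrightarrow> x \<in> family_ones ps"
  by (simp add: family_filling_def)

lemma ones_family_filling:
  assumes "ps \<in> path_families"
  shows "ones (family_filling ps) t =
    (if K \<le> t \<and> t \<le> last_layer then (ps ! (t - K)) ` {..<K} else diag t)"
proof -
  have "ones (family_filling ps) t = diag t \<inter> family_ones ps"
    using family_filling_eq_1 by (auto simp: ones_def diag_def)
  also have "\<dots> = (if K \<le> t \<and> t \<le> last_layer then (ps ! (t - K)) ` {..<K} else diag t)"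
    using tuples_image_subset[OF families_tuples[OF assms, of t]]
    by (auto simp: family_ones_def diag_def simp del: mem_R)
  finally show ?thesis .
qed

text \<open>The row of the \<open>i\<close>-th path on each layer, with the path extended horizontally to both ends.\<close>

definition path_row :: "(nat \<Rightarrow> nat \<times> nat) list \<Rightarrow> nat \<Rightarrow> nat \<Rightarrow> nat" where
  "path_row ps i t = (if t < K then m - i else if t \<le> last_layer then fst ((ps ! (t - K)) i) else K - i)"

lemma path_row_Suc:
  assumes "ps \<in> path_families" "i < K"
  shows "path_row ps i (Suc t) = path_row ps i t \<or> Suc (path_row ps i (Suc t)) = path_row ps i t"
proof -
  consider "Suc t < K" | "Suc t = K" | "K \<le> t" "t < last_layer" | "t = last_layer" | "last_layer < t"
    by linarith
  then show ?thesis
  proof cases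
    \<comment> \<open>Nothing jumps at the two junctions: \<open>start\<close> lies in the rows
      \<open>m - i\<close>, and the last tuple lies in the rows \<open>K - i\<close> by
      \<open>last_layer_row\<close>.\<close>
    case 2
    then show ?thesis
      using families_D(2)[OF assms(1)] K_le_last_layer assms(2) by (simp add: path_row_def start_def)
  next
    case 3
    have "(ps ! (Suc t - K)) i \<in> moves ((ps ! (t - K)) i)"
      using families_D(3)[OF assms(1) 3] assms(2) by (auto simp: succs_def PiE_iff)
    moreover have "(ps ! (t - K)) i \<in> R"
      using families_tuples[OF assms(1), of t] 3 assms(2) by (intro tuples_D(1)) auto
    ultimately show ?thesis
      using moves_cases(3) 3 by (simp add: path_row_def)
  next
    case 4
    then show ?thesis
      using last_layer_row[OF families_tuples[OF assms(1)], of i] assms(2) K_le_last_layer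
      by (simp add: path_row_def)
  qed (use K_le_last_layer in \<open>auto simp: path_row_def\<close>)
qed

text \<open>The row falls by at most 1 per layer. The second bound says that the column never
  decreases, so no box of a path is strictly above and strictly left of another one.\<close>

lemma path_row_mono:
  assumes "ps \<in> path_families" "i < K" "t \<le> s"
  shows "path_row ps i s \<le> path_row ps i t \<and> path_row ps i t \<le> path_row ps i s + (s - t)"
  using assms(3)
proof (induction s rule: dec_induct)
  case (step s)
  then show ?case
    using path_row_Suc[OF assms(1,2), of s] by (auto simp: Suc_diff_le)
qed simp

text \<open>Outside the layers from \<open>K\<close> to \<open>last_layer\<close> the boxes lie in
  the last or in the first \<open>K\<close> rows, which the horizontal extensions cover.\<close>

lemma family_ones_path_row:
  assumes "x \<in> family_ones ps"
  shows "\<exists>i<K. fst x = path_row ps i (layer x)"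
proof -
  have x: "x \<in> R" using assms by (simp add: family_ones_def)
  consider "layer x < K" | "K \<le> layer x" "layer x \<le> last_layer" | "last_layer < layer x"
    by linarith
  then show ?thesis
  proof cases
    case 1
    then have "m - fst x < K" "fst x = m - (m - fst x)"
      using x by (cases x; auto simp: layer_def)+
    then show ?thesis
      using 1 by (intro exI[of _ "m - fst x"]) (simp add: path_row_def)
  next
    case 2
    then show ?thesis
      using assms by (auto simp: family_ones_def path_row_def)
  next
    case 3
    then have "1 \<le> fst x" "fst x \<le> K"
      using x L_le_n[of "fst x"] K_less_m M_top by (cases x; auto simp: layer_def last_layer_def)+
    then show ?thesis
      using 3 K_le_last_layer by (intro exI[of _ "K - fst x"]) (auto simp: path_row_def)
  qed
qed

lemma family_filling_avoiding:
  assumes "ps \<in> path_families"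
  shows "\<not> contains_I R (Suc K) (family_filling ps)"
proof
  assume "contains_I R (Suc K) (family_filling ps)"
  then obtain y where y: "\<forall>i\<le>K. y i \<in> R \<and> family_filling ps (y i) = 1"
    "\<forall>i j. i < j \<longrightarrow> j \<le> K \<longrightarrow> fst (y j) < fst (y i) \<and> snd (y j) < snd (y i)"
    unfolding contains_I_iff_antimono by (elim exE conjE) (rule that)
  have "\<forall>i\<in>{..K}. \<exists>l<K. fst (y i) = path_row ps l (layer (y i))"
  proof
    fix i assume "i \<in> {..K}"
    then have "y i \<in> family_ones ps"
      using y(1) family_filling_eq_1[of "y i" ps] by simp
    then show "\<exists>l<K. fst (y i) = path_row ps l (layer (y i))"
      by (rule family_ones_path_row)
  qed
  from bchoice[OF this] obtain lab
    where lab: "\<forall>i\<in>{..K}. lab i < K \<and> fst (y i) = path_row ps (lab i) (layer (y i))"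
    by (elim exE) (rule that)
  \<comment> \<open>The \<open>K + 1\<close> ones of the chain lie on \<open>K\<close> paths, so two
    of them share a path.\<close>
  have "card (lab ` {..K}) \<le> card {..<K}"
    by (rule card_mono) (use lab in auto)
  then have "\<not> inj_on lab {..K}"
    by (intro pigeonhole) simp
  then obtain i' j' where ij': "i' \<le> K" "j' \<le> K" "i' \<noteq> j'" "lab i' = lab j'"
    by (auto simp: inj_on_def)
  define i where "i = min i' j'"
  define j where "j = max i' j'"
  have ij: "i < j" "j \<le> K" "lab i = lab j"
    using ij' by (auto simp: i_def j_def min_def max_def)
  have less: "fst (y j) < fst (y i)" "snd (y j) < snd (y i)"
    using y(2) ij by auto
  have eq: "fst (y i) = path_row ps (lab j) (layer (y i))" "fst (y j) = path_row ps (lab j) (layer (y j))"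
    "lab j < K"
    using lab ij by auto
  have lay: "int (layer (y i)) = int (snd (y i)) + int m - int (fst (y i))"
    "int (layer (y j)) = int (snd (y j)) + int m - int (fst (y j))"
    using layer_eq y(1) ij by simp_all
  show False
  \<comment> \<open>\<open>y j\<close> is strictly above and left of \<open>y i\<close>. If its
    layer is not earlier, the row would have fallen by more than the layer difference; if it is
    earlier, the row index would have to increase along the path.\<close>
  proof (cases "layer (y i) \<le> layer (y j)")
    case True
    then show False
      using path_row_mono[OF assms eq(3) True] eq less lay by linarith
  next
    case False
    then show False
      using path_row_mono[OF assms eq(3), of "layer (y j)" "layer (y i)"] eq less lay by linarith
  qed
qed

text \<open>Tuples are recovered from the ones on their layers, which gives injectivity. For
  surjectivity the ones on each layer are enumerated as a tuple, and avoidance makes successive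
  tuples differ by moves.\<close>

lemma bij_betw_family_filling:
  "bij_betw family_filling path_families (maximal_fillings R (Suc K))"
proof (rule bij_betw_imageI)
  show "inj_on family_filling path_families"
  proof (rule inj_onI)
    fix ps qs assume pq: "ps \<in> path_families" "qs \<in> path_families" "family_filling ps = family_filling qs"
    show "ps = qs"
    proof (rule nth_equalityI)
      show "length ps = length qs"
        using families_D(1) pq by simp
      fix s assume "s < length ps"
      then have s: "K \<le> s + K" "s + K \<le> last_layer"
        using families_D(1)[OF pq(1)] by auto
      have "(ps ! s) ` {..<K} = (qs ! s) ` {..<K}"
        using ones_family_filling[OF pq(1), of "s + K"] ones_family_filling[OF pq(2), of "s + K"] pq(3) s
        by simp
      then show "ps ! s = qs ! s"
        using tuples_inj[of "ps ! s" "s + K" "qs ! s"] families_tuples[OF pq(1) s] families_tuples[OF pq(2) s]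
        by simp
    qed
  qed
  show "family_filling ` path_families = maximal_fillings R (Suc K)"
  proof (intro equalityI subsetI)
    fix F assume "F \<in> family_filling ` path_families"
    then obtain ps where ps: "ps \<in> path_families" "F = family_filling ps" by blast
    have "card (ones F t) = min K (card (diag t))" for t
    proof (cases "K \<le> t \<and> t \<le> last_layer")
      case True
      then have "card (ones F t) = K"
        using ones_family_filling[OF ps(1), of t] ps tuples_card_image[OF families_tuples[OF ps(1), of t]] by simp
      then show ?thesis
        using K_le_card_diag[of t] True by simp
    next
      case False
      then show ?thesis
        using ones_family_filling[OF ps(1), of t] ps card_diag_le_K[of t] by auto
    qed
    moreover have "F \<in> avoiding_fillings R (Suc K)"
      using family_filling_avoiding[OF ps(1)] ps(2)
      by (auto simp: avoiding_fillings_def fillings_def family_filling_def)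
    ultimately show "F \<in> maximal_fillings R (Suc K)"
      by (simp add: maximal_fillings_eq)
  next
    fix F assume "F \<in> maximal_fillings R (Suc K)"
    then have F: "F \<in> fillings R" "\<not> contains_I R (Suc K) F" "\<And>t. card (ones F t) = min K (card (diag t))"
      by (auto simp: maximal_fillings_eq avoiding_fillings_def)
    \<comment> \<open>Diagonals with at most \<open>K\<close> boxes are filled completely, so only
      the layers in between leave a choice.\<close>
    have full: "ones F t = diag t" if "t \<le> K \<or> last_layer < t" for t
      using F(3)[of t] card_diag_le_K[of t] that
      by (intro card_subset_eq) (auto simp: finite_diag ones_def)
    have "\<forall>t\<in>{K..last_layer}. \<exists>p. p \<in> tuples t \<and> p ` {..<K} = ones F t"
    proof
      fix t assume "t \<in> {K..last_layer}"
      then have "card (ones F t) = K"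
        using F(3)[of t] K_le_card_diag[of t] by simp
      then show "\<exists>p. p \<in> tuples t \<and> p ` {..<K} = ones F t"
        using ex_tuple_image[of "ones F t" t] by (auto simp: ones_def)
    qed
    from bchoice[OF this] obtain p
      where p: "\<forall>t\<in>{K..last_layer}. p t \<in> tuples t \<and> p t ` {..<K} = ones F t"
      by (elim exE) (rule that)
    then have p_tuples: "p t \<in> tuples t" and p_image: "p t ` {..<K} = ones F t"
      if "K \<le> t" "t \<le> last_layer" for t
      using that by auto
    have p_one: "F (p t i) = 1" if "K \<le> t" "t \<le> last_layer" "i < K" for t i
    proof -
      have "p t i \<in> ones F t"
        using that unfolding p_image[OF that(1,2), symmetric] by auto
      then show ?thesis by (simp add: ones_def)
    qed
    define ps where "ps = map p [K..<Suc last_layer]"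
    have nth: "ps ! s = p (K + s)" if "s \<le> last_layer - K" for s
      using that K_le_last_layer by (simp add: ps_def del: upt_Suc)
    \<comment> \<open>Diagonal \<open>K\<close> consists of exactly the \<open>K\<close> boxes of
      \<open>start\<close>, so the first tuple is forced.\<close>
    have "p K = start"
    proof (rule tuples_inj[OF p_tuples start_tuples])
      have "start ` {..<K} = diag K"
        using tuples_image_subset[OF start_tuples] tuples_card_image[OF start_tuples] card_diag_le_K[of K]
        by (intro card_seteq) (auto simp: finite_diag)
      then show "p K ` {..<K} = start ` {..<K}"
        using p_image[of K] full[of K] K_le_last_layer by simp
    qed (use K_le_last_layer in auto)
    moreover have "p (Suc t) \<in> succs (p t)" if "K \<le> t" "t < last_layer" for t
      by (rule avoiding_succs[OF F(2), where t = t]) (use p_tuples p_one that in auto)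
    ultimately have ps: "ps \<in> path_families"
      using K_le_last_layer
      by (auto simp: path_families_def families_def nth) (simp add: ps_def)
    have "F = family_filling ps"
    proof (rule extensionalityI)
      show "F \<in> extensional R" "family_filling ps \<in> extensional R"
        using F(1) by (auto simp: fillings_def PiE_def family_filling_def)
      fix x assume x: "x \<in> R"
      have "ones F (layer x) = ones (family_filling ps) (layer x)"
      proof (cases "K \<le> layer x \<and> layer x \<le> last_layer")
        case True
        then have "ps ! (layer x - K) = p (layer x)"
          using nth[of "layer x - K"] by (simp add: diff_le_mono)
        then show ?thesis
          using True ones_family_filling[OF ps, of "layer x"] p_image[of "layer x"] by simp
      next
        case False
        then have "layer x \<le> K \<or> last_layer < layer x" by auto
        from full[OF this] show ?thesis
          unfolding ones_family_filling[OF ps] using False by (simp only: if_False)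
      qed
      then have "F x = 1 \<longleftrightarrow> family_filling ps x = 1"
        using x by (auto simp: ones_def diag_def simp del: mem_R)
      moreover have "F x \<in> {0, 1}" "family_filling ps x \<in> {0, 1}"
        using F(1) x by (auto simp: fillings_def family_filling_def PiE_iff simp del: mem_R)
      ultimately show "F x = family_filling ps x" by auto
    qed
    then show "F \<in> family_filling ` path_families"
      using ps by blast
  qed
qed

lemma card_maximal_fillings_eq_det_paths:
  "int (card (maximal_fillings R (Suc K))) = det (mat K K (\<lambda>(i, j). paths (K - j) (m - i, 1)))"
  using bij_betw_same_card[OF bij_betw_family_filling]
  by (simp add: det_paths_eq_card_families path_families_def del: One_nat_def)

end

section \<open>Translation from lists of parts to the region\<close>

theorem theorem1p4:
  fixes m n k :: nat and lam mu :: "nat list"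
  assumes "1 \<le> m" and "1 \<le> n" and "2 \<le> k" and "k \<le> min m n"
    and "is_partition lam" and "is_partition mu"
    and "length lam = m" and "length mu = m"
    and "partition_subset mu lam"
    and "lam ! 0 = n"
    and "lam ! (m - 1) \<ge> k"
    and "card {i. i < m \<and> mu ! i = 0} \<ge> k"
    and "int (lam ! 0) - int (mu ! 0) \<ge> int k"
    and "\<exists>\<alpha>. k \<le> \<alpha> \<and> \<alpha> \<le> m \<and> (\<forall>i < \<alpha>. lam ! i = n)"
    and thick: "\<forall>i. i + (k - 1) < m \<longrightarrow> mu ! i + (k - 1) \<le> lam ! (i + (k - 1))"
  shows "int (card (maximal_fillings (skew_diagram lam mu) k)) = 
           det (mat (k - 1) (k - 1) (\<lambda>(i, j).
             f_gamma (k - 1 - (j + 1)) ((i + 1) - 1) (dual_outer lam) (dual_inner mu)))"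
proof -
  define L where "L = (\<lambda>r. lam ! (r - 1))"
  define M where "M = (\<lambda>r. mu ! (r - 1))"
  define K where "K = k - 1"
  have K: "k = Suc K" "1 \<le> K" "K < m" "K < n"
    using assms(3,4) by (auto simp: K_def)
  interpret skew_region L M m n K
  proof
    show "L s \<le> L r" if "1 \<le> r" "r \<le> s" "s \<le> m" for r s
      using that assms(5,7) unfolding L_def by (intro partition_nth_mono) auto
    show "M s \<le> M r" if "1 \<le> r" "r \<le> s" "s \<le> m" for r s
      using that assms(6,8) unfolding M_def by (intro partition_nth_mono) auto
    show "M r \<le> L r" if "1 \<le> r" "r \<le> m" for r
      using that assms(7,9) by (simp add: partition_subset_def M_def L_def)
    show "L r = n" if "1 \<le> r" "r \<le> K" for r
    proof -
      obtain \<alpha> where \<alpha>: "k \<le> \<alpha>" "\<forall>i<\<alpha>. lam ! i = n" using assms(14) by blast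
      have "r - 1 < \<alpha>" using that \<alpha>(1) K(1) by linarith
      then show ?thesis using \<alpha>(2) by (simp add: L_def)
    qed
    show "K < L m"
      using assms(11) K by (simp add: L_def)
    \<comment> \<open>These are the last \<open>K + 1 = k\<close> rows, and \<open>mu\<close> has at
      least \<open>k\<close> zero parts.\<close>
    show "M r = 0" if "m \<le> r + K" "r \<le> m" for r
      unfolding M_def
      using partition_zero_parts[of mu k "r - 1"] assms(6,8,12) that K by auto
    show "M 1 + K < n"
      using assms(10,13) K by (simp add: M_def)
    show "M r + K \<le> L (r + K)" if "1 \<le> r" "r + K \<le> m" for r
    proof -
      have "r - 1 + (k - 1) < m" "r - 1 + (k - 1) = r + K - 1" using that K by auto
      then show ?thesis
        using thick[rule_format, of "r - 1"] K(1) by (simp add: M_def L_def)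
    qed
  qed (use K in auto)
  have "(r, c) \<in> skew_diagram lam mu \<longleftrightarrow> (r, c) \<in> R" for r c
    unfolding mem_R by (simp add: skew_diagram_def assms(7) L_def M_def)
  then have R: "skew_diagram lam mu = R" by auto
  \<comment> \<open>With \<open>i\<close> and \<open>j\<close> counted from 0, deleting
    \<open>K - (j + 1)\<close> first and \<open>i\<close> last parts gives the target row
    \<open>K - j\<close> and the starting row \<open>m - i\<close>.\<close>
  have "f_gamma (k - 1 - (j + 1)) ((i + 1) - 1) (dual_outer lam) (dual_inner mu) = paths (K - j) (m - i, 1)"
    if "i < K" "j < K" for i j
  proof -
    have "f_gamma (K - (j + 1)) i (dual_outer lam) (dual_inner mu) = paths (K - (j + 1) + 1) (m - i, 1)"
      by (rule f_gamma_eq_paths) (use that assms(7,8) in \<open>auto simp: L_def M_def\<close>)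
    moreover have "K - (j + 1) + 1 = K - j" using that by simp
    ultimately show ?thesis by (simp add: K(1))
  qed
  then have "mat K K (\<lambda>(i, j). f_gamma (k - 1 - (j + 1)) ((i + 1) - 1) (dual_outer lam) (dual_inner mu)) =
      mat K K (\<lambda>(i, j). paths (K - j) (m - i, 1))"
    by (intro eq_matI) auto
  then show ?thesis
    using card_maximal_fillings_eq_det_paths R K(1) by simp
qed

end
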